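(* Let $r,\tilde r\ge1$, $D=3r+3\tilde r-2$, and let $\boldsymbol\xi=(\mathbf x,\mathbf y,\mathbf z,\tilde{\mathbf x},\tilde{\mathbf y},\tilde{\mathbf z})$, $\boldsymbol\eta=(\mathbf s,\mathbf t,\mathbf w,\tilde{\mathbf s},\tilde{\mathbf t},\tilde{\mathbf w})$, $\boldsymbol\varphi$ and the formal power series $\boldsymbol\eta(\boldsymbol\xi)$ be as described in the context. For a multi-index $\mathbf q'=(\mathbf m',\mathbf n',\mathbf p',\tilde{\mathbf m}',\tilde{\mathbf n}',\tilde{\mathbf p}')\in\mathbb Z^D$, the Laurent series $\boldsymbol\eta^{\mathbf q'}=\mathbf s^{\mathbf m'}\mathbf t^{\mathbf n'}\mathbf w^{\mathbf p'}\tilde{\mathbf s}^{\tilde{\mathbf m}'}\tilde{\mathbf t}^{\tilde{\mathbf n}'}\tilde{\mathbf w}^{\tilde{\mathbf p}'}$ (with $\boldsymbol\eta=\boldsymbol\eta(\boldsymbol\xi)$) has the expansion $$\boldsymbol\eta^{\mathbf q'}=\sum_{\mathbf q\ge\mathbf q'}\mathcal H_{\mathbf q'\mathbf q}\,\boldsymbol\xi^{\mathbf q},\qquad \mathcal H_{\mathbf q'\mathbf q}=\sum_{i=-1}^{r-1}\sum_{\iota=-1}^{\tilde r-1}\mathcal F^i_{\mathbf q'\mathbf q}\tilde{\mathcal F}^\iota_{\mathbf q'\mathbf q}-\sum_{i=0}^{r-1}\sum_{\iota=0}^{\tilde r-1}\mathcal G^i_{\mathbf q'\mathbf q}\tilde{\mathcal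 G}^\iota_{\mathbf q'\mathbf q},$$ where, for $\mathbf q=(\mathbf m,\mathbf n,\mathbf p,\tilde{\mathbf m},\tilde{\mathbf n},\tilde{\mathbf p})$, $$\mathcal F^i_{\mathbf q'\mathbf q}=\prod_{j=0}^{r-1}\binom{-p_{j-1}-p_j-\delta_{ij}}{m_j-m'_j-\delta_{ij},\ n_j-n'_j}\binom{p_{j-1}+p_j+\delta_{ij}-1}{p_j-p'_j-\sigma_{ij}},$$ $$\mathcal G^i_{\mathbf q'\mathbf q}=\prod_{j=0}^{r-1}\binom{-p_{j-1}-p_j-\delta_{ij}}{m_j-m'_j,\ n_j-n'_j-\delta_{ij}}\binom{p_{j-1}+p_j+\delta_{ij}-1}{p_j-p'_j-\sigma_{ij}},$$ $$\tilde{\mathcal F}^\iota_{\mathbf q'\mathbf q}=\prod_{j=0}^{\tilde r-1}\binom{-\tilde p_{j-1}-\tilde p_j-\delta_{\iota j}}{\tilde m_j-\tilde m'_j-\delta_{\iota j},\ \tilde n_j-\tilde n'_j}\binom{\tilde p_{j-1}+\tilde p_j+\delta_{\iota j}-1}{\tilde p_j-\tilde p'_j-\sigma_{\iota j}},$$ $$\tilde{\mathcal G}^\iota_{\mathbf q'\mathbf q}=\prod_{j=0}^{\tilde r-1}\binom{-\tilde p_{j-1}-\tilde p_j-\delta_{\iota j}}{\tilde m_j-\tilde m'_j,\ \tilde n_j-\tilde n'_j-\delta_{\iota j}}\binom{\tilde p_{j-1}+\tilde p_j+\delta_{\iota j}-1}{\tilde p_j-\tilde p'_j-\sigma_{\iota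 j}}.$$
   Context: Variables: $\mathbf x=(x_0,\dots,x_{r-1})$, $\mathbf y=(y_0,\dots,y_{r-1})$, $\mathbf z=(z_0,\dots,z_{r-2})$, $\tilde{\mathbf x}=(\tilde x_0,\dots,\tilde x_{\tilde r-1})$, $\tilde{\mathbf y}=(\tilde y_0,\dots,\tilde y_{\tilde r-1})$, $\tilde{\mathbf z}=(\tilde z_0,\dots,\tilde z_{\tilde r-2})$ are $D$ independent formal indeterminates; $\boldsymbol\eta$ consists of $s_0,\dots,s_{r-1},t_0,\dots,t_{r-1},w_0,\dots,w_{r-2},\tilde s_0,\dots,\tilde s_{\tilde r-1},\tilde t_0,\dots,\tilde t_{\tilde r-1},\tilde w_0,\dots,\tilde w_{\tilde r-2}$, with conventions $w_{r-1}=\tilde w_{\tilde r-1}=0$. Define $f_i=\tilde g_j=\frac{1+w_0}{1+s_0+t_0}$, $\tilde f_j=g_i=\frac{1+\tilde w_0}{1+\tilde s_0+\tilde t_0}$ ($0\le i\le r-1$, $0\le j\le\tilde r-1$), $h_i=\frac{(1+w_i)(1+w_{i+1})}{(1+s_i+t_i)(1+s_{i+1}+t_{i+1})}$ ($0\le i\le r-2$), and $\tilde h_i$ analogously with tildes ($0\le i\le\tilde r-2$). Then $\boldsymbol\eta(\boldsymbol\xi)$ denotes the unique $D$-tuple of formal power series in $\boldsymbol\xi$ without constant terms satisfying $x_i=s_i/f_i(\boldsymbol\eta)$, $y_i=t_i/g_i(\boldsymbol\eta)$, $z_j=w_j/h_j(\boldsymbol\eta)$, $\tilde x_i=\tilde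 s_i/\tilde f_i(\boldsymbol\eta)$, $\tilde y_i=\tilde t_i/\tilde g_i(\boldsymbol\eta)$, $\tilde z_j=\tilde w_j/\tilde h_j(\boldsymbol\eta)$ for all indices; each $\eta_k$ equals the corresponding $\xi_k$ times a power series with constant term $1$, so $\boldsymbol\eta^{\mathbf q'}$ is a Laurent series. Multi-indices $\mathbf q=(\mathbf m,\mathbf n,\mathbf p,\tilde{\mathbf m},\tilde{\mathbf n},\tilde{\mathbf p})\in\mathbb Z^D$ with $\mathbf m,\mathbf n\in\mathbb Z^r$, $\mathbf p\in\mathbb Z^{r-1}$, etc.; $\boldsymbol\xi^{\mathbf q}=\prod x_i^{m_i}y_i^{n_i}z_j^{p_j}\tilde x_i^{\tilde m_i}\tilde y_i^{\tilde n_i}\tilde z_j^{\tilde p_j}$; $\mathbf q\ge\mathbf q'$ componentwise. Conventions: $p_{r-1}=p'_{r-1}=\tilde p_{\tilde r-1}=\tilde p'_{\tilde r-1}=0$, $p_{-1}=|\mathbf m|+|\tilde{\mathbf n}|$, $\tilde p_{-1}=|\tilde{\mathbf m}|+|\mathbf n|$, where $|\mathbf m|=\sum_j m_j$. $\delta_{ij}$ is the Kronecker delta and $\sigma_{ij}=0$ if $i\le j$, $\sigma_{ij}=1$ if $i>j$. For integers $a,m,n$: $\binom{a}{m}=[x^m](1+x)^a$ and $\binom{a}{m,n}=[x^my^n](1+x+y)^a$ (coefficients in formal power series, so $\binom am=a(a-1)\cdots(a-m+1)/m!$, $\binom{a}{m,n}=a(a-1)\cdots(a-m-n+1)/(m!n!)$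 for $m,n\ge0$, and these vanish if any lower index is negative). *)

theory Defs
  imports Complex_Main "HOL-Library.Poly_Mapping"
    "HOL-Computational_Algebra.Formal_Laurent_Series"
begin

section \<open>Multi-indices\<close>

text \<open>
  A multi-index assigns an integer exponent to every variable, almost all of them zero. The
  relation \<open>mi_le\<close> is the componentwise order; the order that the library puts on
  \<open>poly_mapping\<close> is lexicographic.
\<close>

type_synonym 'v multi_index = "'v \<Rightarrow>\<^sub>0 int"

definition mi_le :: "'v multi_index \<Rightarrow> 'v multi_index \<Rightarrow> bool" where
  "mi_le p q \<longleftrightarrow> (\<forall>v. Poly_Mapping.lookup p v \<le> Poly_Mapping.lookup q v)"

lemma mi_le_refl: "mi_le p p"
  by (simp add: mi_le_def)

lemma mi_leD: "mi_le p q \<Longrightarrow> Poly_Mapping.lookup p v \<le> Poly_Mapping.lookup q v"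
  by (simp add: mi_le_def)

lemma mi_le_trans: "mi_le p q \<Longrightarrow> mi_le q s \<Longrightarrow> mi_le p s"
  unfolding mi_le_def by (blast intro: order_trans)

lemma mi_le_diff_iff: "mi_le p (q - s) \<longleftrightarrow> mi_le s (q - p)"
proof -
  have "Poly_Mapping.lookup p v \<le> Poly_Mapping.lookup q v - Poly_Mapping.lookup s v \<longleftrightarrow>
      Poly_Mapping.lookup s v \<le> Poly_Mapping.lookup q v - Poly_Mapping.lookup p v" for v
    by linarith
  then show ?thesis by (simp only: mi_le_def lookup_minus)
qed

lemma finite_mi_interval: "finite {q. mi_le l q \<and> mi_le q u}"
proof -
  define K where "K = Poly_Mapping.keys l \<union> Poly_Mapping.keys u"
  define W where "W = (\<Union>w\<in>K. {Poly_Mapping.lookup l w..Poly_Mapping.lookup u w})"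
  have "finite {f. \<forall>v. (v \<in> K \<longrightarrow> f v \<in> W) \<and> (v \<notin> K \<longrightarrow> f v = (0 :: int))}"
    by (rule finite_set_of_finite_funs) (simp_all add: K_def W_def)
  moreover have "Poly_Mapping.lookup ` {q. mi_le l q \<and> mi_le q u}
      \<subseteq> {f. \<forall>v. (v \<in> K \<longrightarrow> f v \<in> W) \<and> (v \<notin> K \<longrightarrow> f v = 0)}"
  proof clarify
    fix q v assume q: "mi_le l q" "mi_le q u"
    have b: "Poly_Mapping.lookup l v \<le> Poly_Mapping.lookup q v"
      "Poly_Mapping.lookup q v \<le> Poly_Mapping.lookup u v"
      using q by (simp_all add: mi_leD)
    then have "Poly_Mapping.lookup q v = 0" if "v \<notin> K"
      using that by (simp add: K_def in_keys_iff)
    then show "(v \<in> K \<longrightarrow> Poly_Mapping.lookup q v \<in> W) \<and> (v \<notin> K \<longrightarrow> Poly_Mapping.lookup q v = 0)"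
      using b by (auto simp: W_def)
  qed
  ultimately have "finite (Poly_Mapping.lookup ` {q. mi_le l q \<and> mi_le q u})"
    by (rule finite_subset[rotated])
  then show ?thesis
    by (rule finite_imageD) (simp add: inj_on_def lookup_inject)
qed

section \<open>Formal Laurent series in several variables\<close>

text \<open>
  Families of coefficients whose support is bounded below by a single multi-index. For a finite
  set of variables this is the ring of formal power series with the variables inverted.
\<close>

typedef (overloaded) ('v, 'a) mfls =
  "{f :: 'v multi_index \<Rightarrow> 'a::zero. \<exists>b. \<forall>q. f q \<noteq> 0 \<longrightarrow> mi_le b q}"
  morphisms mfls_nth Abs_mfls
  by (rule exI[of _ "\<lambda>_. 0"]) simp

setup_lifting type_definition_mfls

lemma mfls_eqI: "(\<And>q. mfls_nth f q = mfls_nth g q) \<Longrightarrow> f = g"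
  by transfer (simp add: fun_eq_iff)

lemma mfls_lower_bound: "\<exists>b. \<forall>q. mfls_nth f q \<noteq> 0 \<longrightarrow> mi_le b q"
  using mfls_nth[of f] by simp

text \<open>The index set below is finite, by \<open>finite_mi_interval\<close>.\<close>

definition mi_conv ::
  "('v multi_index \<Rightarrow> 'a::semiring_0) \<Rightarrow> ('v multi_index \<Rightarrow> 'a) \<Rightarrow> 'v multi_index \<Rightarrow> 'a" where
  "mi_conv f g q = (\<Sum>a | f a \<noteq> 0 \<and> g (q - a) \<noteq> 0. f a * g (q - a))"

lemma mi_conv_interval:
  assumes "\<And>q. f q \<noteq> 0 \<Longrightarrow> mi_le k q" "\<And>q. g q \<noteq> 0 \<Longrightarrow> mi_le l q"
    and "\<And>v. Poly_Mapping.lookup u v + Poly_Mapping.lookup l v \<ge> Poly_Mapping.lookup q v"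
  shows "mi_conv f g q = (\<Sum>a | mi_le k a \<and> mi_le a u. f a * g (q - a))"
  unfolding mi_conv_def
proof (rule sum.mono_neutral_left[OF finite_mi_interval])
  show "{a. f a \<noteq> 0 \<and> g (q - a) \<noteq> 0} \<subseteq> {a. mi_le k a \<and> mi_le a u}"
  proof clarify
    fix a assume a: "f a \<noteq> 0" "g (q - a) \<noteq> 0"
    have "Poly_Mapping.lookup a v \<le> Poly_Mapping.lookup u v" for v
      using mi_leD[OF assms(2)[OF a(2)], of v] assms(3)[of v] by (simp add: lookup_minus)
    then show "mi_le k a \<and> mi_le a u"
      using assms(1)[OF a(1)] by (simp add: mi_le_def)
  qed
qed auto

lemma mi_conv_nonzero:
  assumes "\<And>q. f q \<noteq> 0 \<Longrightarrow> mi_le k q" "\<And>q. g q \<noteq> 0 \<Longrightarrow> mi_le l q" "mi_conv f g q \<noteq> 0"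
  shows "mi_le (k + l) q"
proof -
  obtain a where a: "f a \<noteq> 0" "g (q - a) \<noteq> 0"
    using assms(3) unfolding mi_conv_def by (rule sum.not_neutral_contains_not_neutral) blast
  have "Poly_Mapping.lookup k v + Poly_Mapping.lookup l v \<le> Poly_Mapping.lookup q v" for v
    using mi_leD[OF assms(1)[OF a(1)], of v] mi_leD[OF assms(2)[OF a(2)], of v]
    by (simp add: lookup_minus)
  then show ?thesis by (simp add: mi_le_def lookup_add)
qed

instantiation mfls :: (type, comm_ring_1) comm_ring_1
begin

lift_definition zero_mfls :: "('a, 'b) mfls" is "\<lambda>_. 0" by simp

lift_definition one_mfls :: "('a, 'b) mfls" is "\<lambda>q. if q = 0 then 1 else 0"
  by (rule exI[of _ 0]) (simp add: mi_le_refl)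

lift_definition plus_mfls :: "('a, 'b) mfls \<Rightarrow> ('a, 'b) mfls \<Rightarrow> ('a, 'b) mfls"
  is "\<lambda>f g q. f q + g q"
proof -
  fix f g :: "'a multi_index \<Rightarrow> 'b"
  assume "\<exists>b. \<forall>q. f q \<noteq> 0 \<longrightarrow> mi_le b q" "\<exists>b. \<forall>q. g q \<noteq> 0 \<longrightarrow> mi_le b q"
  then obtain k l where kl: "\<And>q. f q \<noteq> 0 \<Longrightarrow> mi_le k q" "\<And>q. g q \<noteq> 0 \<Longrightarrow> mi_le l q" by blast
  let ?b = "Abs_poly_mapping (\<lambda>v. min (Poly_Mapping.lookup k v) (Poly_Mapping.lookup l v))"
  have "{v. min (Poly_Mapping.lookup k v) (Poly_Mapping.lookup l v) \<noteq> 0} \<subseteq> Poly_Mapping.keys k \<union> Poly_Mapping.keys l"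
    by (auto simp: in_keys_iff min_def split: if_splits)
  then have "finite {v. min (Poly_Mapping.lookup k v) (Poly_Mapping.lookup l v) \<noteq> 0}"
    by (rule finite_subset) simp
  then have b: "Poly_Mapping.lookup ?b v = min (Poly_Mapping.lookup k v) (Poly_Mapping.lookup l v)" for v by simp
  have "mi_le ?b q" if "f q + g q \<noteq> 0" for q
  proof -
    from that have "f q \<noteq> 0 \<or> g q \<noteq> 0" by auto
    then have "mi_le k q \<or> mi_le l q" using kl by blast
    then show ?thesis unfolding mi_le_def b by (auto simp: min_le_iff_disj)
  qed
  then show "\<exists>b. \<forall>q. f q + g q \<noteq> 0 \<longrightarrow> mi_le b q" by blast
qed

lift_definition uminus_mfls :: "('a, 'b) mfls \<Rightarrow> ('a, 'b) mfls" is "\<lambda>f q. - f q" by simp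

definition minus_mfls :: "('a, 'b) mfls \<Rightarrow> ('a, 'b) mfls \<Rightarrow> ('a, 'b) mfls" where
  "minus_mfls f g = f + - g"

lift_definition times_mfls :: "('a, 'b) mfls \<Rightarrow> ('a, 'b) mfls \<Rightarrow> ('a, 'b) mfls" is mi_conv
proof -
  fix f g :: "'a multi_index \<Rightarrow> 'b"
  assume "\<exists>b. \<forall>q. f q \<noteq> 0 \<longrightarrow> mi_le b q" "\<exists>b. \<forall>q. g q \<noteq> 0 \<longrightarrow> mi_le b q"
  then obtain k l where kl: "\<And>q. f q \<noteq> 0 \<Longrightarrow> mi_le k q" "\<And>q. g q \<noteq> 0 \<Longrightarrow> mi_le l q" by blast
  have "mi_le (k + l) q" if "mi_conv f g q \<noteq> 0" for q
    using kl that by (rule mi_conv_nonzero)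
  then show "\<exists>b. \<forall>q. mi_conv f g q \<noteq> 0 \<longrightarrow> mi_le b q" by blast
qed

instance
proof
  fix f g h :: "('a, 'b) mfls"
  show "f + g + h = f + (g + h)" "f + g = g + f" "0 + f = f" "- f + f = 0" 
    by (transfer; simp add: fun_eq_iff algebra_simps)+
  show "f - g = f + - g" by (simp add: minus_mfls_def)
  show "(0 :: ('a, 'b) mfls) \<noteq> 1"
    by transfer (auto simp: fun_eq_iff)
  obtain kf where kf: "\<And>q. mfls_nth f q \<noteq> 0 \<Longrightarrow> mi_le kf q" using mfls_lower_bound by blast
  obtain kg where kg: "\<And>q. mfls_nth g q \<noteq> 0 \<Longrightarrow> mi_le kg q" using mfls_lower_bound by blast
  obtain kh where kh: "\<And>q. mfls_nth h q \<noteq> 0 \<Longrightarrow> mi_le kh q" using mfls_lower_bound by blast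
  show "f * g = g * f"
  proof (rule mfls_eqI)
    fix q
    have "mi_conv (mfls_nth f) (mfls_nth g) q = mi_conv (mfls_nth g) (mfls_nth f) q"
      unfolding mi_conv_def
      by (rule sum.reindex_bij_witness[of _ "\<lambda>a. q - a" "\<lambda>a. q - a"]) (auto simp: mult.commute)
    then show "mfls_nth (f * g) q = mfls_nth (g * f) q" by (simp add: times_mfls.rep_eq)
  qed
  show "1 * f = f"
  proof (rule mfls_eqI)
    fix q
    have "mi_conv (\<lambda>q. if q = 0 then 1 else 0) (mfls_nth f) q
      = (\<Sum>a\<in>{0}. (if a = 0 then 1 else 0) * mfls_nth f (q - a))"
      unfolding mi_conv_def by (rule sum.mono_neutral_left) auto
    then show "mfls_nth (1 * f) q = mfls_nth f q"
      by (simp add: times_mfls.rep_eq one_mfls.rep_eq)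
  qed
  show "(f + g) * h = f * h + g * h"
  proof (rule mfls_eqI)
    fix q
    obtain k where k: "\<And>q. mfls_nth (f + g) q \<noteq> 0 \<Longrightarrow> mi_le k q" using mfls_lower_bound by blast
    let ?b = "Abs_poly_mapping (\<lambda>v. min (Poly_Mapping.lookup k v) (min (Poly_Mapping.lookup kf v) (Poly_Mapping.lookup kg v)))"
    have "{v. min (Poly_Mapping.lookup k v) (min (Poly_Mapping.lookup kf v) (Poly_Mapping.lookup kg v)) \<noteq> 0} \<subseteq> Poly_Mapping.keys k \<union> Poly_Mapping.keys kf \<union> Poly_Mapping.keys kg"
      by (auto simp: in_keys_iff min_def split: if_splits)
    then have "finite {v. min (Poly_Mapping.lookup k v) (min (Poly_Mapping.lookup kf v) (Poly_Mapping.lookup kg v)) \<noteq> 0}"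
      by (rule finite_subset) simp
    then have b: "Poly_Mapping.lookup ?b v = min (Poly_Mapping.lookup k v) (min (Poly_Mapping.lookup kf v) (Poly_Mapping.lookup kg v))" for v by simp
    have *: "mi_conv (mfls_nth x) (mfls_nth h) q
        = (\<Sum>a | mi_le ?b a \<and> mi_le a (q - kh). mfls_nth x a * mfls_nth h (q - a))"
      if "x \<in> {f, g, f + g}" for x
    proof (rule mi_conv_interval[where l = kh])
      show "mi_le ?b p" if "mfls_nth x p \<noteq> 0" for p
        using that \<open>x \<in> _\<close> k[of p] kf[of p] kg[of p] unfolding mi_le_def b
        by (auto simp: min_le_iff_disj)
    qed (auto simp: kh lookup_minus)
    show "mfls_nth ((f + g) * h) q = mfls_nth (f * h + g * h) q"
      using *[of f] *[of g] *[of "f + g"]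
      by (simp add: times_mfls.rep_eq plus_mfls.rep_eq algebra_simps sum.distrib)
  qed
  show "f * g * h = f * (g * h)"
  proof (rule mfls_eqI)
    fix q
    let ?F = "mfls_nth f" and ?G = "mfls_nth g" and ?H = "mfls_nth h"
    have fg: "mi_le (kf + kg) p" if "mi_conv ?F ?G p \<noteq> 0" for p
      using mi_conv_nonzero[OF kf kg that] .
    have gh: "mi_le (kg + kh) p" if "mi_conv ?G ?H p \<noteq> 0" for p
      using mi_conv_nonzero[OF kg kh that] .
    define A where "A = {a. mi_le (kf + kg) a \<and> mi_le a (q - kh)}"
    define B where "B = {b. mi_le kf b \<and> mi_le b (q - kg - kh)}"
    define S where "S = {(a, b). mi_le kf b \<and> mi_le kg (a - b) \<and> mi_le kh (q - a)}"
    have fin: "finite A" "finite B" by (simp_all add: A_def B_def finite_mi_interval)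
    have "mi_conv (mi_conv ?F ?G) ?H q = (\<Sum>a\<in>A. mi_conv ?F ?G a * ?H (q - a))"
      unfolding A_def by (rule mi_conv_interval[OF fg kh]) (auto simp: lookup_minus)
    also have "\<dots> = (\<Sum>a\<in>A. \<Sum>b | mi_le kf b \<and> mi_le b (a - kg). ?F b * ?G (a - b) * ?H (q - a))"
      by (intro sum.cong refl, subst mi_conv_interval[OF kf kg, where u = "_ - kg"])
         (auto simp: lookup_minus sum_distrib_right)
    also have "\<dots> = (\<Sum>(a, b)\<in>(SIGMA a:A. {b. mi_le kf b \<and> mi_le b (a - kg)}). ?F b * ?G (a - b) * ?H (q - a))"
      using fin finite_mi_interval by (subst sum.Sigma) auto
    also have "(SIGMA a:A. {b. mi_le kf b \<and> mi_le b (a - kg)}) = S"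
    proof -
      have "mi_le (kf + kg) a" if "mi_le kf b" "mi_le b (a - kg)" for a b
      proof -
        have "mi_le kf (a - kg)" using that by (rule mi_le_trans)
        then show ?thesis by (simp add: mi_le_def lookup_minus lookup_add le_diff_eq)
      qed
      then show ?thesis
        unfolding A_def S_def by (auto simp: mi_le_diff_iff[of kg] mi_le_diff_iff[of kh])
    qed
    also have "(\<Sum>(a, b)\<in>S. ?F b * ?G (a - b) * ?H (q - a))
      = (\<Sum>(b, c)\<in>(SIGMA b:B. {c. mi_le kg c \<and> mi_le c (q - b - kh)}). ?F b * (?G c * ?H (q - b - c)))"
    proof (rule sum.reindex_bij_witness[of _ "\<lambda>(b, c). (b + c, b)" "\<lambda>(a, b). (b, a - b)"])
      fix x assume "x \<in> S"
      then obtain a b where x: "x = (a, b)"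
        and ab: "mi_le kf b" "mi_le kg (a - b)" "mi_le kh (q - a)"
        by (auto simp: S_def)
      have "mi_le b (q - kg - kh)"
        unfolding mi_le_def
      proof
        fix v show "Poly_Mapping.lookup b v \<le> Poly_Mapping.lookup (q - kg - kh) v"
          using mi_leD[OF ab(2), of v] mi_leD[OF ab(3), of v] by (simp add: lookup_minus)
      qed
      moreover have "mi_le (a - b) (q - b - kh)"
        unfolding mi_le_def
      proof
        fix v show "Poly_Mapping.lookup (a - b) v \<le> Poly_Mapping.lookup (q - b - kh) v"
          using mi_leD[OF ab(3), of v] by (simp add: lookup_minus)
      qed
      ultimately show "(case x of (a, b) \<Rightarrow> (b, a - b))
          \<in> (SIGMA b:B. {c. mi_le kg c \<and> mi_le c (q - b - kh)})"
        using ab by (simp add: x B_def)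
    next
      fix x assume "x \<in> (SIGMA b:B. {c. mi_le kg c \<and> mi_le c (q - b - kh)})"
      then obtain b c where x: "x = (b, c)"
        and bc: "mi_le kf b" "mi_le kg c" "mi_le c (q - b - kh)"
        by (auto simp: B_def)
      have "mi_le kh (q - (b + c))"
        unfolding mi_le_def
      proof
        fix v show "Poly_Mapping.lookup kh v \<le> Poly_Mapping.lookup (q - (b + c)) v"
          using mi_leD[OF bc(3), of v] by (simp add: lookup_minus lookup_add)
      qed
      then show "(case x of (b, c) \<Rightarrow> (b + c, b)) \<in> S"
        using bc by (simp add: x S_def)
    qed (auto simp: mult.assoc diff_diff_eq)
    also have "\<dots> = (\<Sum>b\<in>B. \<Sum>c | mi_le kg c \<and> mi_le c (q - b - kh). ?F b * (?G c * ?H (q - b - c)))"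
      using fin finite_mi_interval by (subst sum.Sigma) auto
    also have "\<dots> = (\<Sum>b\<in>B. ?F b * mi_conv ?G ?H (q - b))"
      by (intro sum.cong refl, subst mi_conv_interval[OF kg kh, where u = "_ - kh"])
         (auto simp: lookup_minus sum_distrib_left)
    also have "\<dots> = mi_conv ?F (mi_conv ?G ?H) q"
      unfolding B_def by (rule mi_conv_interval[OF kf gh, symmetric]) (auto simp: lookup_minus lookup_add)
    finally show "mfls_nth (f * g * h) q = mfls_nth (f * (g * h)) q"
      by (simp add: times_mfls.rep_eq)
  qed
qed

end

text \<open>
  In several variables the Laurent series do not form a field; \<open>inverse\<close> is the ring inverse of a
  unit and \<open>0\<close> on all other series.
\<close>

instantiation mfls :: (type, comm_ring_1) inverse
begin

definition inverse_mfls :: "('a, 'b) mfls \<Rightarrow> ('a, 'b) mfls" where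
  "inverse_mfls f = (if f dvd 1 then THE g. f * g = 1 else 0)"

definition divide_mfls :: "('a, 'b) mfls \<Rightarrow> ('a, 'b) mfls \<Rightarrow> ('a, 'b) mfls" where
  "divide_mfls f g = f * inverse g"

instance ..

end

lemma mfls_inverse_eqI:
  fixes f g :: "('v, 'a::comm_ring_1) mfls"
  assumes "f * g = 1"
  shows "inverse f = g"
proof -
  have "h = g" if "f * h = 1" for h
  proof -
    have "h = (f * g) * h" using assms by simp
    also have "\<dots> = (f * h) * g" by (simp only: mult_ac)
    finally show ?thesis using that by simp
  qed
  with assms have "(THE h. f * h = 1) = g" by (rule the_equality)
  moreover have "f dvd 1" by (rule dvdI[OF assms[symmetric]])
  ultimately show ?thesis by (simp add: inverse_mfls_def)
qed

lift_definition mfls_X :: "'v \<Rightarrow> ('v, 'a::comm_ring_1) mfls"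
  is "\<lambda>v q. if q = Poly_Mapping.single v 1 then 1 else 0"
  by (metis mi_le_refl)

definition power_series_in :: "'v set \<Rightarrow> ('v, 'a::comm_ring_1) mfls set" where
  "power_series_in V =
     {f. \<forall>q. mfls_nth f q \<noteq> 0 \<longrightarrow> Poly_Mapping.keys q \<subseteq> V \<and> mi_le 0 q}"

section \<open>Binomial and trinomial coefficients\<close>

text \<open>
  These are \<open>[x\<^sup>m] (1 + x)\<^sup>a\<close> and \<open>[x\<^sup>m y\<^sup>n] (1 + x + y)\<^sup>a\<close>; the variables
  \<open>x\<close> and \<open>y\<close> are \<open>mfls_X False\<close> and \<open>mfls_X True\<close>.
\<close>

definition binom :: "int \<Rightarrow> int \<Rightarrow> 'a::field_char_0" where
  "binom a m = fls_nth ((1 + fls_X) powi a) m"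

definition trinom :: "int \<Rightarrow> int \<Rightarrow> int \<Rightarrow> 'a::field_char_0" where
  "trinom a m n = mfls_nth ((1 + mfls_X False + mfls_X True) powi a)
     (Poly_Mapping.single False m + Poly_Mapping.single True n)"

section \<open>The change of variables\<close>

text \<open>
  The constructors, in order, name \<open>x\<^sub>i\<close>, \<open>y\<^sub>i\<close>, \<open>z\<^sub>i\<close> and their versions with a tilde. They index
  the tuple \<open>\<xi>\<close> as well as the tuple \<open>\<eta>\<close>: \<open>\<xi>\<close> is \<open>mfls_X\<close>, and \<open>s\<^sub>i\<close>, \<open>t\<^sub>i\<close>, \<open>w\<^sub>i\<close> are
  \<open>\<eta> (VX i)\<close>, \<open>\<eta> (VY i)\<close>, \<open>\<eta> (VZ i)\<close>.
\<close>

datatype var = VX nat | VY nat | VZ nat | VXt nat | VYt nat | VZt nat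

definition vars :: "nat \<Rightarrow> nat \<Rightarrow> var set" where
  "vars r rt = VX ` {..<r} \<union> VY ` {..<r} \<union> VZ ` {..<r - 1}
     \<union> VXt ` {..<rt} \<union> VYt ` {..<rt} \<union> VZt ` {..<rt - 1}"

definition multi_indices :: "nat \<Rightarrow> nat \<Rightarrow> var multi_index set" where
  "multi_indices r rt = {q. Poly_Mapping.keys q \<subseteq> vars r rt}"

text \<open>The tuples \<open>w\<close>, extended by zero at \<open>r - 1\<close>.\<close>

definition wser :: "nat \<Rightarrow> (var \<Rightarrow> (var, 'a::comm_ring_1) mfls) \<Rightarrow> nat \<Rightarrow> (var, 'a) mfls" where
  "wser r \<eta> i = (if i < r - 1 then \<eta> (VZ i) else 0)"

definition wtser :: "nat \<Rightarrow> (var \<Rightarrow> (var, 'a::comm_ring_1) mfls) \<Rightarrow> nat \<Rightarrow> (var, 'a) mfls" where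
  "wtser rt \<eta> i = (if i < rt - 1 then \<eta> (VZt i) else 0)"

text \<open>
  The components of \<open>\<phi>(\<eta>)\<close>: \<open>f\<close>, \<open>g\<close>, \<open>h\<close> and their versions with a tilde. The series \<open>f\<close> and
  \<open>g\<close> of one block are the series \<open>g\<close> and \<open>f\<close> of the other, and do not depend on the index.
\<close>

primrec phi ::
  "nat \<Rightarrow> nat \<Rightarrow> (var \<Rightarrow> (var, 'a::comm_ring_1) mfls) \<Rightarrow> var \<Rightarrow> (var, 'a) mfls" where
  "phi r rt \<eta> (VX i) = (1 + wser r \<eta> 0) / (1 + \<eta> (VX 0) + \<eta> (VY 0))"
| "phi r rt \<eta> (VY i) = (1 + wtser rt \<eta> 0) / (1 + \<eta> (VXt 0) + \<eta> (VYt 0))"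
| "phi r rt \<eta> (VZ i) = ((1 + wser r \<eta> i) * (1 + wser r \<eta> (i + 1)))
     / ((1 + \<eta> (VX i) + \<eta> (VY i)) * (1 + \<eta> (VX (i + 1)) + \<eta> (VY (i + 1))))"
| "phi r rt \<eta> (VXt j) = (1 + wtser rt \<eta> 0) / (1 + \<eta> (VXt 0) + \<eta> (VYt 0))"
| "phi r rt \<eta> (VYt j) = (1 + wser r \<eta> 0) / (1 + \<eta> (VX 0) + \<eta> (VY 0))"
| "phi r rt \<eta> (VZt j) = ((1 + wtser rt \<eta> j) * (1 + wtser rt \<eta> (j + 1)))
     / ((1 + \<eta> (VXt j) + \<eta> (VYt j)) * (1 + \<eta> (VXt (j + 1)) + \<eta> (VYt (j + 1))))"

text \<open>Values of \<open>\<eta>\<close> outside \<open>vars r rt\<close> are irrelevant.\<close>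

definition is_eta :: "nat \<Rightarrow> nat \<Rightarrow> (var \<Rightarrow> (var, 'a::comm_ring_1) mfls) \<Rightarrow> bool" where
  "is_eta r rt \<eta> \<longleftrightarrow>
     (\<forall>v\<in>vars r rt. \<eta> v \<in> power_series_in (vars r rt) \<and> mfls_nth (\<eta> v) 0 = 0
        \<and> mfls_X v = \<eta> v / phi r rt \<eta> v)"

section \<open>The coefficients of the expansion\<close>

text \<open>Indices are integers here, since \<open>i\<close>, \<open>\<iota>\<close> and the index of \<open>p\<close> start at \<open>-1\<close>.\<close>

definition m_of :: "var multi_index \<Rightarrow> int \<Rightarrow> int" where
  "m_of q j = Poly_Mapping.lookup q (VX (nat j))"

definition n_of :: "var multi_index \<Rightarrow> int \<Rightarrow> int" where
  "n_of q j = Poly_Mapping.lookup q (VY (nat j))"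

definition mt_of :: "var multi_index \<Rightarrow> int \<Rightarrow> int" where
  "mt_of q j = Poly_Mapping.lookup q (VXt (nat j))"

definition nt_of :: "var multi_index \<Rightarrow> int \<Rightarrow> int" where
  "nt_of q j = Poly_Mapping.lookup q (VYt (nat j))"

definition p_of :: "nat \<Rightarrow> nat \<Rightarrow> var multi_index \<Rightarrow> int \<Rightarrow> int" where
  "p_of r rt q j =
     (if j = -1 then (\<Sum>k=0..int r - 1. m_of q k) + (\<Sum>k=0..int rt - 1. nt_of q k)
      else if j = int r - 1 then 0
      else Poly_Mapping.lookup q (VZ (nat j)))"

definition pt_of :: "nat \<Rightarrow> nat \<Rightarrow> var multi_index \<Rightarrow> int \<Rightarrow> int" where
  "pt_of r rt q j =
     (if j = -1 then (\<Sum>k=0..int rt - 1. mt_of q k) + (\<Sum>k=0..int r - 1. n_of q k)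
      else if j = int rt - 1 then 0
      else Poly_Mapping.lookup q (VZt (nat j)))"

definition kron :: "int \<Rightarrow> int \<Rightarrow> int" where
  "kron i j = (if i = j then 1 else 0)"

definition sig :: "int \<Rightarrow> int \<Rightarrow> int" where
  "sig i j = (if i \<le> j then 0 else 1)"

definition calF ::
  "nat \<Rightarrow> nat \<Rightarrow> var multi_index \<Rightarrow> var multi_index \<Rightarrow> int \<Rightarrow> 'a::field_char_0" where
  "calF r rt q' q i = (\<Prod>j=0..int r - 1.
     trinom (- p_of r rt q (j - 1) - p_of r rt q j - kron i j)
       (m_of q j - m_of q' j - kron i j) (n_of q j - n_of q' j) *
     binom (p_of r rt q (j - 1) + p_of r rt q j + kron i j - 1)
       (p_of r rt q j - p_of r rt q' j - sig i j))"

definition calG ::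
  "nat \<Rightarrow> nat \<Rightarrow> var multi_index \<Rightarrow> var multi_index \<Rightarrow> int \<Rightarrow> 'a::field_char_0" where
  "calG r rt q' q i = (\<Prod>j=0..int r - 1.
     trinom (- p_of r rt q (j - 1) - p_of r rt q j - kron i j)
       (m_of q j - m_of q' j) (n_of q j - n_of q' j - kron i j) *
     binom (p_of r rt q (j - 1) + p_of r rt q j + kron i j - 1)
       (p_of r rt q j - p_of r rt q' j - sig i j))"

definition calFt ::
  "nat \<Rightarrow> nat \<Rightarrow> var multi_index \<Rightarrow> var multi_index \<Rightarrow> int \<Rightarrow> 'a::field_char_0" where
  "calFt r rt q' q \<iota> = (\<Prod>j=0..int rt - 1.
     trinom (- pt_of r rt q (j - 1) - pt_of r rt q j - kron \<iota> j)
       (mt_of q j - mt_of q' j - kron \<iota> j) (nt_of q j - nt_of q' j) *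
     binom (pt_of r rt q (j - 1) + pt_of r rt q j + kron \<iota> j - 1)
       (pt_of r rt q j - pt_of r rt q' j - sig \<iota> j))"

definition calGt ::
  "nat \<Rightarrow> nat \<Rightarrow> var multi_index \<Rightarrow> var multi_index \<Rightarrow> int \<Rightarrow> 'a::field_char_0" where
  "calGt r rt q' q \<iota> = (\<Prod>j=0..int rt - 1.
     trinom (- pt_of r rt q (j - 1) - pt_of r rt q j - kron \<iota> j)
       (mt_of q j - mt_of q' j) (nt_of q j - nt_of q' j - kron \<iota> j) *
     binom (pt_of r rt q (j - 1) + pt_of r rt q j + kron \<iota> j - 1)
       (pt_of r rt q j - pt_of r rt q' j - sig \<iota> j))"

definition calH ::
  "nat \<Rightarrow> nat \<Rightarrow> var multi_index \<Rightarrow> var multi_index \<Rightarrow> 'a::field_char_0" where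
  "calH r rt q' q =
     (\<Sum>i=-1..int r - 1. \<Sum>\<iota>=-1..int rt - 1. calF r rt q' q i * calFt r rt q' q \<iota>)
     - (\<Sum>i=0..int r - 1. \<Sum>\<iota>=0..int rt - 1. calG r rt q' q i * calGt r rt q' q \<iota>)"

end

theory Submission
  imports Defs "HOL-Library.Disjoint_Sets"
begin

text \<open>
  Write \<open>\<phi>\<^sup>q\<close> for \<open>phi_pow\<close>. From \<open>\<xi>\<^sup>q = \<eta>\<^sup>q \<phi>(\<eta>)\<^sup>-\<^sup>q\<close> one gets
  \<open>\<xi>\<^sup>q = \<Sum>\<^sub>p M\<^sub>q\<^sub>p \<eta>\<^sup>p\<close> with \<open>M\<^sub>q\<^sub>p = [X\<^bsup>p-q\<^esup>] \<phi>(X)\<^sup>-\<^sup>q\<close>, so that the wanted matrix of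
  coefficients of \<open>\<eta>\<^sup>p\<close> is the inverse of \<open>M\<close>, which is unitriangular for the componentwise order.
  On the other hand \<open>H\<^sub>p\<^sub>q = [X\<^bsup>q-p\<^esup>] \<phi>(X)\<^sup>q J(X)\<close> for an explicit series \<open>J\<close> (in the Lagrange-Good
  formula, a Jacobian determinant). Multiplying series, \<open>(M H)\<^sub>p\<^sub>q = [X\<^bsup>q-p\<^esup>] \<phi>(X)\<^bsup>q-p\<^esup> J(X) =
  H\<^bsub>0,q-p\<^esub>\<close>, and it remains to see that \<open>H\<^bsub>0,q\<^esub>\<close> vanishes unless \<open>q = 0\<close>. By the absorption
  identities all terms of \<open>H\<^bsub>0,q\<^esub>\<close> are multiples of one product: up to a common factor the sums
  over \<open>\<F>\<close>, its tilde version, \<open>\<G>\<close> and its tilde version are \<open>|nt|\<close>, \<open>|n|\<close>, \<open>-|n|\<close> and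
  \<open>-|nt|\<close>, and these cancel.
\<close>

text \<open>With \<open>u_j = (1 + w_j) / (1 + s_j + t_j)\<close>, every component of phi is
  \<open>u_0\<close>, its tilde version, or a product \<open>u_j u_(j+1)\<close> within one block.
  So \<open>q\<close> enters phi^q only through the exponents \<open>p_(j-1) + p_j\<close> of the
  \<open>u_j\<close>, and the convention for \<open>p_(-1)\<close> collects the exponents of all
  components equal to \<open>u_0\<close>. Different \<open>u_j\<close> involve different variables;
  hence the coefficients are products of one trinomial and one binomial for each \<open>j\<close>,
  and the two blocks interact only through \<open>p_(-1)\<close> and its tilde version.
  \<open>J\<close> does not come from a determinant: it is read off from the shifts by delta and
  sigma in H, and the vanishing of H_(0,q) for nonzero \<open>q\<close> takes the place of
  evaluating a Jacobian. No derivatives or residues occur. The obstacle is that absorption divides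
  by \<open>p_(j-1) + p_j\<close>, which may be zero. But for \<open>q \<ge> 0\<close>, once some
  \<open>p_(j-1)\<close> is zero, the rest of the base product is \<open>1\<close> if all remaining
  exponents vanish and \<open>0\<close> otherwise. So the identity splits into cases according to
  whether \<open>p_(-1)\<close> and its tilde version are zero.\<close>

abbreviation "lkp \<equiv> Poly_Mapping.lookup"
abbreviation "kys \<equiv> Poly_Mapping.keys"
abbreviation "sgl \<equiv> Poly_Mapping.single"

section \<open>Coefficients of sums and products of series\<close>

lemma mfls_nth_0 [simp]: "mfls_nth 0 q = 0"
  by (simp add: zero_mfls.rep_eq)

lemma mfls_nth_1: "mfls_nth 1 q = (if q = 0 then 1 else 0)"
  by (simp add: one_mfls.rep_eq)

lemma mfls_nth_add [simp]: "mfls_nth (f + g) q = mfls_nth f q + mfls_nth g q"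
  by (simp add: plus_mfls.rep_eq)

lemma mfls_nth_uminus [simp]: "mfls_nth (- f) q = - mfls_nth f q"
  by (simp add: uminus_mfls.rep_eq)

lemma mfls_nth_diff [simp]: "mfls_nth (f - g) q = mfls_nth f q - mfls_nth g q"
  by (simp only: minus_mfls_def mfls_nth_add mfls_nth_uminus) simp

lemma mfls_nth_sum: "mfls_nth (sum f A) q = (\<Sum>x\<in>A. mfls_nth (f x) q)"
  by (induction A rule: infinite_finite_induct) simp_all

text \<open>The index set of \<open>mi_conv\<close> depends on the supports; a fixed interval given
  by lower bounds allows sums to be exchanged and reindexed.\<close>

lemma mfls_nth_mult_interval:
  assumes "\<And>q. mfls_nth f q \<noteq> 0 \<Longrightarrow> mi_le k q" "\<And>q. mfls_nth g q \<noteq> 0 \<Longrightarrow> mi_le l q"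
  shows "mfls_nth (f * g) q = (\<Sum>a | mi_le k a \<and> mi_le a (q - l). mfls_nth f a * mfls_nth g (q - a))"
  unfolding times_mfls.rep_eq
proof (rule mi_conv_interval)
  show "lkp (q - l) v + lkp l v \<ge> lkp q v" for v by (simp add: lookup_minus)
qed (fact assms)+

section \<open>Monomials and units\<close>

definition mfls_mono :: "'v multi_index \<Rightarrow> ('v, 'a::comm_ring_1) mfls" where
  "mfls_mono p = Abs_mfls (\<lambda>q. if q = p then 1 else 0)"

lemma mfls_nth_mono:
  "mfls_nth (mfls_mono p :: ('v, 'a::comm_ring_1) mfls) q = (if q = p then 1 else 0)"
proof -
  have "\<exists>b. \<forall>q. (if q = p then 1 else 0 :: 'a) \<noteq> 0 \<longrightarrow> mi_le b q"
    by (metis mi_le_refl)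
  then show ?thesis by (simp add: mfls_mono_def Abs_mfls_inverse)
qed

lemma mfls_X_eq_mono: "mfls_X v = mfls_mono (sgl v 1)"
  by (rule mfls_eqI) (simp add: mfls_nth_mono mfls_X.rep_eq)

lemma mfls_mono_0: "mfls_mono 0 = 1"
  by (rule mfls_eqI) (simp add: mfls_nth_mono mfls_nth_1)

lemma mfls_nth_mono_mult: "mfls_nth (mfls_mono p * f) q = mfls_nth f (q - p)"
proof -
  have "mi_conv (mfls_nth (mfls_mono p)) (mfls_nth f) q
      = (\<Sum>a\<in>{p}. mfls_nth (mfls_mono p) a * mfls_nth f (q - a))"
    unfolding mi_conv_def
    by (rule sum.mono_neutral_left) (auto simp: mfls_nth_mono split: if_splits)
  then show ?thesis by (simp add: times_mfls.rep_eq mfls_nth_mono)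
qed

lemma mfls_mono_add: "mfls_mono (p + q) = mfls_mono p * mfls_mono q"
  by (rule mfls_eqI) (auto simp: mfls_nth_mono_mult mfls_nth_mono algebra_simps)

lemma mfls_mono_unit: "mfls_mono p dvd 1"
  by (rule dvdI[of _ _ "mfls_mono (- p)"]) (simp flip: mfls_mono_add add: mfls_mono_0)

lemma mfls_inverse_mult:
  fixes f :: "('v, 'a::comm_ring_1) mfls"
  assumes "f dvd 1"
  shows "f * inverse f = 1"
proof -
  from assms obtain g where g: "1 = f * g" by (rule dvdE)
  then have "inverse f = g" by (intro mfls_inverse_eqI) simp
  with g show ?thesis by simp
qed

lemma mfls_inverse_unit:
  fixes f :: "('v, 'a::comm_ring_1) mfls"
  assumes "f dvd 1"
  shows "inverse f dvd 1"
  using mfls_inverse_mult[OF assms] by (intro dvdI[of _ _ f]) (simp add: mult.commute)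

lemma mfls_mult_unit:
  fixes f g :: "('v, 'a::comm_ring_1) mfls"
  shows "f dvd 1 \<Longrightarrow> g dvd 1 \<Longrightarrow> f * g dvd 1"
  using mult_dvd_mono[of f 1 g 1] by simp

text \<open>In this ring the laws of integer powers are guaranteed only for units. Stepping across
  the exponent zero is where \<open>f * inverse f = 1\<close> enters.\<close>

lemma mfls_powi_Suc:
  fixes f :: "('v, 'a::comm_ring_1) mfls"
  assumes "f dvd 1"
  shows "f powi (n + 1) = f powi n * f"
proof (cases "n \<ge> 0")
  case True
  then show ?thesis by (simp add: power_int_def nat_add_distrib)
next
  case False
  define k where "k = nat (- n - 1)"
  have "n = - int k - 1" "nat (- n) = Suc k" using False by (auto simp: k_def)
  moreover have "f * inverse f * inverse f ^ k = inverse f ^ k"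
    by (simp add: mfls_inverse_mult[OF assms])
  \<comment> \<open>The case \<open>k = 0\<close> is \<open>n = - 1\<close>, where
    \<open>n + 1\<close> falls into the nonnegative branch of the integer power.\<close>
  ultimately show ?thesis
    by (cases "k = 0") (auto simp: power_int_def mult_ac)
qed

lemma mfls_powi_add:
  fixes f :: "('v, 'a::comm_ring_1) mfls"
  assumes "f dvd 1"
  shows "f powi (m + n) = f powi m * f powi n"
proof (induction n rule: int_induct[where k = 0])
  case base
  then show ?case by simp
next
  case (step1 n)
  then show ?case
    using mfls_powi_Suc[OF assms, of "m + n"] mfls_powi_Suc[OF assms, of n]
    by (simp add: algebra_simps)
next
  case (step2 n)
  have "f powi (m + (n - 1)) * f = f powi m * f powi (n - 1) * f"
    using mfls_powi_Suc[OF assms, of "m + (n - 1)"] mfls_powi_Suc[OF assms, of "n - 1"] step2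
    by (simp add: algebra_simps)
  then have "f powi (m + (n - 1)) * (f * inverse f) = f powi m * f powi (n - 1) * (f * inverse f)"
    by (simp only: mult.assoc [symmetric])
  then show ?case by (simp add: mfls_inverse_mult[OF assms])
qed

lemma mfls_powi_sum:
  fixes f :: "('v, 'a::comm_ring_1) mfls"
  assumes "f dvd 1"
  shows "f powi (sum g A) = (\<Prod>x\<in>A. f powi g x)"
  by (induction A rule: infinite_finite_induct) (simp_all add: mfls_powi_add[OF assms])

lemma mfls_inverse_mult_distrib:
  fixes f g :: "('v, 'a::comm_ring_1) mfls"
  assumes "f dvd 1" "g dvd 1"
  shows "inverse (f * g) = inverse f * inverse g"
proof (rule mfls_inverse_eqI)
  have "f * g * (inverse f * inverse g) = (f * inverse f) * (g * inverse g)" by (simp only: mult_ac)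
  then show "f * g * (inverse f * inverse g) = 1" using assms by (simp add: mfls_inverse_mult)
qed

lemma mfls_powi_mult_distrib:
  fixes f g :: "('v, 'a::comm_ring_1) mfls"
  assumes "f dvd 1" "g dvd 1"
  shows "(f * g) powi n = f powi n * g powi n"
  using assms by (simp add: power_int_def mfls_inverse_mult_distrib power_mult_distrib)

lemma mfls_inverse_powi:
  fixes f :: "('v, 'a::comm_ring_1) mfls"
  assumes "f dvd 1"
  shows "inverse f powi n = f powi (- n)"
proof -
  have "inverse (inverse f) = f"
    using mfls_inverse_mult[OF assms] by (intro mfls_inverse_eqI) (simp add: mult.commute)
  then show ?thesis by (auto simp: power_int_def)
qed

lemma mfls_X_powi: "mfls_X v powi k = (mfls_mono (sgl v k) :: ('v, 'a::comm_ring_1) mfls)"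
proof -
  have u: "(mfls_X v :: ('v, 'a) mfls) dvd 1" by (simp add: mfls_X_eq_mono mfls_mono_unit)
  show ?thesis
  proof (induction k rule: int_induct[where k = 0])
    case base
    then show ?case by (simp add: mfls_mono_0)
  next
    case (step1 n)
    then show ?case
      unfolding mfls_powi_Suc[OF u] single_add mfls_mono_add by (simp only: mfls_X_eq_mono)
  next
    case (step2 n)
    have "mfls_X v powi (n - 1) = mfls_X v powi n * (mfls_X v :: ('v, 'a) mfls) powi (-1)"
      using mfls_powi_add[OF u, of n "-1"] by simp
    also have "(mfls_X v :: ('v, 'a) mfls) powi (-1) = mfls_mono (sgl v (-1))"
      by (simp add: power_int_def, rule mfls_inverse_eqI)
         (simp add: mfls_X_eq_mono mfls_mono_0 flip: mfls_mono_add single_add)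
    finally show ?case using step2 by (simp add: mfls_mono_0 flip: mfls_mono_add single_add)
  qed
qed

lemma mfls_prod_X_powi:
  "(\<Prod>v\<in>A. mfls_X v powi lkp q v) = (mfls_mono (\<Sum>v\<in>A. sgl v (lkp q v)) :: ('v, 'a::comm_ring_1) mfls)"
  by (induction A rule: infinite_finite_induct)
     (simp_all add: mfls_X_powi mfls_mono_0 mfls_mono_add)

lemma mi_sum_singles:
  assumes "finite A" "kys q \<subseteq> A"
  shows "(\<Sum>v\<in>A. sgl v (lkp q v)) = (q :: 'v multi_index)"
proof (rule poly_mapping_eqI)
  fix w
  have "lkp (\<Sum>v\<in>A. sgl v (lkp q v)) w = (\<Sum>v\<in>A. lkp (sgl v (lkp q v)) w)"
    using assms(1) by (induction A rule: finite_induct) (simp_all add: lookup_add)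
  also have "\<dots> = (\<Sum>v\<in>A. if v = w then lkp q w else 0)"
    by (intro sum.cong refl) (auto simp: lookup_single when_def)
  also have "\<dots> = lkp q w"
    using assms by (auto simp: in_keys_iff)
  finally show "lkp (\<Sum>v\<in>A. sgl v (lkp q v)) w = lkp q w" .
qed

section \<open>Power series\<close>

lemma power_series_inD:
  assumes "f \<in> power_series_in V" "mfls_nth f q \<noteq> 0"
  shows "kys q \<subseteq> V" "mi_le 0 q"
  using assms by (auto simp: power_series_in_def)

lemma power_series_in_mono: "V \<subseteq> W \<Longrightarrow> f \<in> power_series_in V \<Longrightarrow> f \<in> power_series_in W"
  by (auto simp: power_series_in_def)

lemma power_series_in_0: "0 \<in> power_series_in V"
  by (simp add: power_series_in_def)

lemma power_series_in_1: "1 \<in> power_series_in V"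
  by (simp add: power_series_in_def mfls_nth_1 mi_le_refl)

lemma power_series_in_uminus: "f \<in> power_series_in V \<Longrightarrow> - f \<in> power_series_in V"
  by (simp add: power_series_in_def)

lemma power_series_in_add:
  "f \<in> power_series_in V \<Longrightarrow> g \<in> power_series_in V \<Longrightarrow> f + g \<in> power_series_in V"
  unfolding power_series_in_def mem_Collect_eq mfls_nth_add by (metis add_0)

lemma power_series_in_diff:
  "f \<in> power_series_in V \<Longrightarrow> g \<in> power_series_in V \<Longrightarrow> f - g \<in> power_series_in V"
  unfolding minus_mfls_def by (intro power_series_in_add power_series_in_uminus)

lemma power_series_in_sum:
  "(\<And>i. i \<in> I \<Longrightarrow> f i \<in> power_series_in V) \<Longrightarrow> sum f I \<in> power_series_in V"
  by (induction I rule: infinite_finite_induct) (simp_all add: power_series_in_0 power_series_in_add)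

lemma power_series_in_X: "v \<in> V \<Longrightarrow> mfls_X v \<in> power_series_in V"
  by (auto simp: power_series_in_def mfls_X.rep_eq mi_le_def lookup_single when_def)

lemma mi_conv_terms:
  assumes "mi_conv f g q \<noteq> 0"
  obtains a where "f a \<noteq> 0" "g (q - a) \<noteq> 0"
  using assms unfolding mi_conv_def by (rule sum.not_neutral_contains_not_neutral) blast

lemma power_series_in_mult:
  assumes "f \<in> power_series_in V" "g \<in> power_series_in V"
  shows "f * g \<in> power_series_in V"
  unfolding power_series_in_def
proof clarify
  fix q assume "mfls_nth (f * g) q \<noteq> 0"
  then obtain a where a: "mfls_nth f a \<noteq> 0" "mfls_nth g (q - a) \<noteq> 0"
    unfolding times_mfls.rep_eq by (rule mi_conv_terms)
  note b = power_series_inD[OF assms(1) a(1)] power_series_inD[OF assms(2) a(2)]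
  have "lkp q v \<ge> 0" for v
    using mi_leD[OF b(2), of v] mi_leD[OF b(4), of v] by (simp add: lookup_minus)
  then have "mi_le 0 q" by (simp add: mi_le_def)
  moreover have "kys (a + (q - a)) \<subseteq> V" using keys_add[of a "q - a"] b by blast
  then have "kys q \<subseteq> V" by simp
  ultimately show "kys q \<subseteq> V \<and> mi_le 0 q" by simp
qed

text \<open>Nonnegative exponents add up to \<open>0\<close> only as \<open>0 + 0\<close>.\<close>

lemma mfls_nth_mult_0:
  assumes "f \<in> power_series_in V" "g \<in> power_series_in W"
  shows "mfls_nth (f * g) 0 = mfls_nth f 0 * mfls_nth g 0"
proof -
  have "mfls_nth (f * g) 0 = (\<Sum>a | mi_le 0 a \<and> mi_le a (0 - 0). mfls_nth f a * mfls_nth g (0 - a))"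
    using assms by (intro mfls_nth_mult_interval) (auto dest: power_series_inD)
  also have "{a. mi_le 0 a \<and> mi_le a (0 - 0)} = {0 :: 'a multi_index}"
    by (auto simp: mi_le_def intro!: poly_mapping_eqI antisym)
  finally show ?thesis by simp
qed

text \<open>The variables of the factors are disjoint, so only one splitting of the exponent contributes.\<close>

lemma mfls_nth_mult_disjoint:
  assumes "f \<in> power_series_in V" "g \<in> power_series_in W" "V \<inter> W = {}"
    and "kys a \<subseteq> V" "kys b \<subseteq> W"
  shows "mfls_nth (f * g) (a + b) = mfls_nth f a * mfls_nth g b"
proof -
  have "c = a" if c: "mfls_nth f c \<noteq> 0" "mfls_nth g (a + b - c) \<noteq> 0" for c
  proof (rule poly_mapping_eqI)
    fix v
    have V: "lkp c v = 0 \<and> lkp a v = 0" if "v \<notin> V"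
      using power_series_inD(1)[OF assms(1) c(1)] assms(4) that in_keys_iff[of v] by blast
    have W: "lkp (a + b - c) v = 0 \<and> lkp b v = 0" if "v \<notin> W"
      using power_series_inD(1)[OF assms(2) c(2)] assms(5) that in_keys_iff[of v] by blast
    from assms(3) have "v \<notin> V \<or> v \<notin> W" by blast
    then show "lkp c v = lkp a v"
    proof
      assume "v \<notin> V"
      then show ?thesis using V by simp
    next
      assume "v \<notin> W"
      then show ?thesis using W by (simp add: lookup_add lookup_minus)
    qed
  qed
  then have "mi_conv (mfls_nth f) (mfls_nth g) (a + b)
      = (\<Sum>c\<in>{a}. mfls_nth f c * mfls_nth g (a + b - c))"
    unfolding mi_conv_def by (intro sum.mono_neutral_left) auto
  then show ?thesis by (simp add: times_mfls.rep_eq)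
qed

lemma power_series_in_prod:
  assumes "\<And>i. i \<in> I \<Longrightarrow> f i \<in> power_series_in V"
  shows "prod f I \<in> power_series_in V"
  using assms by (induction I rule: infinite_finite_induct)
    (auto intro: power_series_in_mult power_series_in_1)

lemma mfls_nth_prod_disjoint:
  fixes f :: "'i \<Rightarrow> ('v, 'a::comm_ring_1) mfls"
  assumes "finite I" "\<And>i. i \<in> I \<Longrightarrow> f i \<in> power_series_in (V i)" "\<And>i. i \<in> I \<Longrightarrow> kys (a i) \<subseteq> V i"
    and "disjoint_family_on V I"
  shows "mfls_nth (prod f I) (sum a I) = (\<Prod>i\<in>I. mfls_nth (f i) (a i))"
  using assms
proof (induction I rule: finite_induct)
  case empty
  then show ?case by (simp add: mfls_nth_1)
next
  case (insert i I)
  have "mfls_nth (f i * prod f I) (a i + sum a I) = mfls_nth (f i) (a i) * mfls_nth (prod f I) (sum a I)"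
  proof (rule mfls_nth_mult_disjoint)
    show "prod f I \<in> power_series_in (\<Union>i\<in>I. V i)"
      by (rule power_series_in_prod, rule power_series_in_mono[OF _ insert.prems(1)]) blast+
    show "kys (sum a I) \<subseteq> (\<Union>i\<in>I. V i)"
      by (rule order_trans[OF keys_sum UN_mono]) (simp_all add: insert.prems(2))
    show "V i \<inter> (\<Union>i\<in>I. V i) = {}"
      using insert.prems(3) insert.hyps(2) by (auto simp: disjoint_family_on_def)
    show "f i \<in> power_series_in (V i)" "kys (a i) \<subseteq> V i" by (simp_all add: insert.prems)
  qed
  moreover have "mfls_nth (prod f I) (sum a I) = (\<Prod>i\<in>I. mfls_nth (f i) (a i))"
    by (rule insert.IH) (use insert.prems(3) in \<open>auto simp: insert.prems(1,2) disjoint_family_on_def\<close>)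
  ultimately show ?case using insert.hyps by simp
qed

section \<open>Power series with constant term 1\<close>

definition unit_series_in :: "'v set \<Rightarrow> ('v, 'a::comm_ring_1) mfls set" where
  "unit_series_in V = {f \<in> power_series_in V. mfls_nth f 0 = 1}"

text \<open>\<open>nat\<close> cuts negative exponents off to zero, so this is meant as the total
  degree of indices above \<open>0\<close>, where it is additive. It bounds geometric series and
  measures the final downward induction.\<close>

definition mi_deg :: "'v multi_index \<Rightarrow> nat" where
  "mi_deg q = (\<Sum>v\<in>kys q. nat (lkp q v))"

lemma mi_deg_eq:
  assumes "finite A" "kys q \<subseteq> A"
  shows "mi_deg q = (\<Sum>v\<in>A. nat (lkp q v))"
  unfolding mi_deg_def using assms by (intro sum.mono_neutral_left) (auto simp: in_keys_iff)

lemma mi_deg_add: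
  assumes "mi_le 0 p" "mi_le 0 q"
  shows "mi_deg (p + q) = mi_deg p + mi_deg q"
proof -
  let ?A = "kys p \<union> kys q"
  have "mi_deg (p + q) = (\<Sum>v\<in>?A. nat (lkp (p + q) v))"
    using keys_add[of p q] by (intro mi_deg_eq) auto
  also have "\<dots> = (\<Sum>v\<in>?A. nat (lkp p v)) + (\<Sum>v\<in>?A. nat (lkp q v))"
    using mi_leD[OF assms(1)] mi_leD[OF assms(2)]
    by (simp add: lookup_add nat_add_distrib sum.distrib)
  also have "\<dots> = mi_deg p + mi_deg q"
    by (simp add: mi_deg_eq[of ?A p] mi_deg_eq[of ?A q])
  finally show ?thesis .
qed

lemma mi_deg_pos:
  assumes "mi_le 0 q" "q \<noteq> 0"
  shows "mi_deg q > 0"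
proof -
  obtain v where v: "lkp q v \<noteq> 0" using assms(2) by (metis lookup_zero poly_mapping_eqI)
  then have "nat (lkp q v) > 0" using mi_leD[OF assms(1), of v] by simp
  then show ?thesis unfolding mi_deg_def using v
    by (intro sum_pos2[of _ v]) (auto simp: in_keys_iff)
qed

text \<open>Every factor lacks a constant term and hence raises the total degree by at least
  one.\<close>

lemma mfls_nth_power_low_degree:
  assumes "f \<in> power_series_in V" "mfls_nth f 0 = 0" "mi_deg q < n"
  shows "mfls_nth (f ^ n) q = 0"
  using assms(3)
proof (induction n arbitrary: q)
  case (Suc n)
  show ?case
  proof (rule ccontr)
    have p: "f ^ n \<in> power_series_in V"
      by (induction n) (auto intro: power_series_in_1 power_series_in_mult assms(1))
    assume "\<not> ?case"
    then obtain a where a: "mfls_nth f a \<noteq> 0" "mfls_nth (f ^ n) (q - a) \<noteq> 0"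
      unfolding power_Suc times_mfls.rep_eq using mi_conv_terms by blast
    have "mi_deg a > 0"
      using power_series_inD[OF assms(1) a(1)] a(1) assms(2) by (intro mi_deg_pos) auto
    moreover have "mi_deg (a + (q - a)) = mi_deg a + mi_deg (q - a)"
      using power_series_inD[OF assms(1) a(1)] power_series_inD[OF p a(2)] by (intro mi_deg_add)
    ultimately have "mi_deg (q - a) < n" using Suc.prems by simp
    then show False using Suc.IH a(2) by blast
  qed
qed simp

text \<open>Geometric series in \<open>h = 1 - f\<close>, defined coefficientwise: at
  \<open>q\<close> only the powers \<open>h ^ n\<close> with \<open>n \<le> mi_deg q\<close>
  contribute.\<close>

lemma unit_series_has_inverse:
  fixes f :: "('v, 'a::comm_ring_1) mfls"
  assumes "f \<in> unit_series_in V"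
  shows "\<exists>g \<in> unit_series_in V. f * g = 1"
proof -
  define h where "h = 1 - f"
  have h: "h \<in> power_series_in V" "mfls_nth h 0 = 0"
    using assms power_series_in_add[OF power_series_in_1 power_series_in_uminus, of f V]
    by (auto simp: h_def unit_series_in_def mfls_nth_1)
  have hn: "h ^ n \<in> power_series_in V" for n
    by (induction n) (auto intro: power_series_in_1 power_series_in_mult h)
  define G where "G q = (\<Sum>n\<le>mi_deg q. mfls_nth (h ^ n) q)" for q
  have supp: "kys q \<subseteq> V \<and> mi_le 0 q" if "G q \<noteq> 0" for q
    using that power_series_inD[OF hn] unfolding G_def
    by (metis (no_types, lifting) sum.not_neutral_contains_not_neutral)
  define g where "g = Abs_mfls G"
  have g: "mfls_nth g = G" unfolding g_def
    using supp by (intro Abs_mfls_inverse) blast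
  have gp: "g \<in> power_series_in V" using supp by (auto simp: power_series_in_def g)
  have G: "G q = mfls_nth (\<Sum>n\<le>N. h ^ n) q" if "mi_deg q \<le> N" for q N
    unfolding G_def mfls_nth_sum
    using that by (intro sum.mono_neutral_left) (auto intro: mfls_nth_power_low_degree[OF h])
  have "mfls_nth (f * g) q = mfls_nth 1 q" for q
  proof (cases "mi_le 0 q")
    case True
    define N where "N = mi_deg q"
    define s where "s = (\<Sum>n\<le>N. h ^ n)"
    have sp: "s \<in> power_series_in V" unfolding s_def
      by (induction N) (auto intro: power_series_in_add hn power_series_in_1 simp flip: power_Suc simp del: power_Suc)
    \<comment> \<open>The coefficient at \<open>q\<close> sees \<open>g\<close> only in degrees up
      to \<open>N\<close>, where \<open>g\<close> agrees with the partial sum \<open>s\<close>; and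
      \<open>f * s\<close> telescopes.\<close>
    have "mfls_nth (f * g) q = mfls_nth (f * s) q"
    proof -
      have "mfls_nth g (q - a) = mfls_nth s (q - a)" if "mi_le 0 a" "mi_le a q" for a
      proof -
        have "mi_deg (a + (q - a)) = mi_deg a + mi_deg (q - a)"
          using that by (intro mi_deg_add) (auto simp: mi_le_def lookup_minus)
        then have "mi_deg (q - a) \<le> N" by (simp add: N_def)
        then show ?thesis using G by (simp add: g s_def)
      qed
      moreover have "mfls_nth (f * x) q
          = (\<Sum>a | mi_le 0 a \<and> mi_le a (q - 0). mfls_nth f a * mfls_nth x (q - a))"
        if "x \<in> {g, s}" for x
        using that gp sp assms
        by (intro mfls_nth_mult_interval) (auto simp: unit_series_in_def dest: power_series_inD)
      ultimately show ?thesis by simp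
    qed
    also have "f * s = 1 - h ^ Suc N"
    proof -
      have f: "f = 1 - h" by (simp add: h_def)
      show ?thesis unfolding f s_def using one_diff_power_eq[of h "Suc N"]
        by (simp only: lessThan_Suc_atMost)
    qed
    also have "mfls_nth (1 - h ^ Suc N) q = mfls_nth 1 q"
      unfolding mfls_nth_diff using mfls_nth_power_low_degree[OF h, of q "Suc N"] by (simp add: N_def)
    finally show ?thesis .
  next
    case False
    have "f * g \<in> power_series_in V" 
      using assms gp by (auto simp: unit_series_in_def intro: power_series_in_mult)
    then have "mfls_nth (f * g) q = 0" using False power_series_inD by blast
    then show ?thesis using False by (auto simp: mfls_nth_1 mi_le_refl)
  qed
  then have "f * g = 1" by (rule mfls_eqI)
  moreover from this have "mfls_nth g 0 = 1"
    using mfls_nth_mult_0[of f V g V] assms gp by (simp add: unit_series_in_def mfls_nth_1)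
  ultimately show ?thesis using gp by (auto simp: unit_series_in_def)
qed

lemma unit_series_in_unit: "f \<in> unit_series_in V \<Longrightarrow> f dvd 1"
  using unit_series_has_inverse by (metis dvdI)

lemma unit_series_in_inverse: "f \<in> unit_series_in V \<Longrightarrow> inverse f \<in> unit_series_in V"
  using unit_series_has_inverse by (metis mfls_inverse_eqI)

lemma unit_series_in_1: "1 \<in> unit_series_in V"
  by (simp add: unit_series_in_def power_series_in_1 mfls_nth_1)

lemma unit_series_in_mult:
  "f \<in> unit_series_in V \<Longrightarrow> g \<in> unit_series_in V \<Longrightarrow> f * g \<in> unit_series_in V"
  by (auto simp: unit_series_in_def mfls_nth_mult_0 intro: power_series_in_mult)

lemma unit_series_in_powi: 
  assumes "f \<in> unit_series_in V" shows "f powi n \<in> unit_series_in V"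
proof -
  have "f ^ n \<in> unit_series_in V" if "f \<in> unit_series_in V" for n and f :: "('a, 'b) mfls"
    using that by (induction n) (auto intro: unit_series_in_1 unit_series_in_mult)
  then show ?thesis using assms by (simp add: power_int_def unit_series_in_inverse)
qed

lemma unit_series_in_prod:
  "(\<And>i. i \<in> I \<Longrightarrow> f i \<in> unit_series_in V) \<Longrightarrow> prod f I \<in> unit_series_in V"
  by (induction I rule: infinite_finite_induct) (auto intro: unit_series_in_mult unit_series_in_1)

lemma unit_series_in_add:
  "f \<in> unit_series_in V \<Longrightarrow> g \<in> power_series_in V \<Longrightarrow> mfls_nth g 0 = 0 \<Longrightarrow> f + g \<in> unit_series_in V"
  by (auto simp: unit_series_in_def intro: power_series_in_add)

lemma unit_series_in_power_series: "f \<in> unit_series_in V \<Longrightarrow> f \<in> power_series_in V"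
  by (simp add: unit_series_in_def)

section \<open>Binomial and trinomial coefficients in closed form\<close>

text \<open>The value \<open>a(a-1)...(a-m-n+1) / (m! n!)\<close>, split into two binomials so that
  Pascal's rule applies to each.\<close>

definition tri :: "'a::field_char_0 \<Rightarrow> int \<Rightarrow> int \<Rightarrow> 'a" where
  "tri a m n = (if m < 0 \<or> n < 0 then 0
     else (a gchoose nat (m + n)) * of_nat (nat (m + n) choose nat m))"

lemma tri_0: "tri 0 m n = (if m = 0 \<and> n = 0 then 1 else 0)"
  by (auto simp: tri_def gbinomial_0_left)

lemma tri_nat: "tri a (int m) (int n) = (a gchoose (m + n)) * of_nat ((m + n) choose m)"
  by (simp add: tri_def flip: of_nat_add)

text \<open>Multiplication by \<open>1 + x + y\<close> on coefficients: Pascal's rule in both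
  factors. The cases \<open>i = 0\<close> and \<open>j = 0\<close> are treated apart because a
  summand with index \<open>-1\<close> drops out.\<close>

lemma tri_rec: "tri (a + 1) m n = tri a m n + tri a (m - 1) n + tri a m (n - 1)"
proof (cases "m < 0 \<or> n < 0")
  case True
  then show ?thesis by (auto simp: tri_def)
next
  case False
  then obtain i j where mn: "m = int i" "n = int j" by (metis nat_0_le not_less)
  show ?thesis
  proof (cases i)
    case 0
    show ?thesis
    proof (cases j)
      case (Suc j')
      have "int (Suc j') - 1 = int j'" by simp
      then show ?thesis unfolding mn 0 Suc
        using tri_nat[of "a + 1" 0 "Suc j'"] tri_nat[of a 0 "Suc j'"] tri_nat[of a 0 "j'"]
        by (simp add: gbinomial_Suc_Suc tri_def[of _ "-1"])
    qed (simp add: tri_def mn 0)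
  next
    case (Suc i')
    have i: "int (Suc i') - 1 = int i'" by simp
    show ?thesis
    proof (cases j)
      case 0
      then show ?thesis unfolding mn 0 Suc i
        using tri_nat[of "a + 1" "Suc i'" 0] tri_nat[of a "Suc i'" 0] tri_nat[of a "i'" 0]
        by (simp add: gbinomial_Suc_Suc tri_def[of _ _ "-1"])
    next
      case (Suc j')
      have j: "int (Suc j') - 1 = int j'" by simp
      let ?k = "Suc (i' + j')"
      have "tri (a + 1) (int (Suc i')) (int (Suc j'))
          = ((a gchoose Suc ?k) + (a gchoose ?k)) * of_nat (Suc ?k choose Suc i')"
        unfolding tri_nat by (simp add: gbinomial_Suc_Suc[of a])
      moreover have "tri a (int (Suc i')) (int (Suc j')) = (a gchoose Suc ?k) * of_nat (Suc ?k choose Suc i')"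
        unfolding tri_nat by simp
      moreover have "tri a (int i') (int (Suc j')) = (a gchoose ?k) * of_nat (?k choose i')"
        unfolding tri_nat by simp
      moreover have "tri a (int (Suc i')) (int j') = (a gchoose ?k) * of_nat (?k choose Suc i')"
        unfolding tri_nat by simp
      ultimately show ?thesis unfolding mn \<open>i = _\<close> Suc i j
        by (simp add: algebra_simps)
    qed
  qed
qed

text \<open>The recursion can be run upwards and downwards in \<open>a\<close>.\<close>

lemma trinomial_recursion_unique:
  fixes T :: "int \<Rightarrow> int \<Rightarrow> int \<Rightarrow> 'a::field_char_0"
  assumes "\<And>m n. T 0 m n = (if m = 0 \<and> n = 0 then 1 else 0)"
    and "\<And>a m n. m < 0 \<or> n < 0 \<Longrightarrow> T a m n = 0"
    and "\<And>a m n. T (a + 1) m n = T a m n + T a (m - 1) n + T a m (n - 1)"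
  shows "T a m n = tri (of_int a) m n"
proof (induction a arbitrary: m n rule: int_induct[where k = 0])
  case base
  then show ?case by (simp add: assms(1) tri_0)
next
  case (step1 a)
  then show ?case by (simp add: assms(3) tri_rec)
next
  case (step2 a)
  show ?case
  \<comment> \<open>Going down, the recursion gives the value at \<open>a - 1\<close> from one at
    \<open>a\<close> and two at \<open>a - 1\<close> with smaller \<open>m + n\<close>; hence the
    inner induction.\<close>
  proof (induction "nat (m + n)" arbitrary: m n rule: less_induct)
    case less
    show ?case
    proof (cases "m < 0 \<or> n < 0")
      case True
      then show ?thesis by (auto simp: assms(2) tri_def)
    next
      case False
      have "T (a - 1) (m - 1) n = tri (of_int (a - 1)) (m - 1) n"
      proof (cases "m = 0")
        case True
        then show ?thesis by (simp add: assms(2) tri_def)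
      next
        case m: False
        show ?thesis using False m by (intro less) auto
      qed
      moreover have "T (a - 1) m (n - 1) = tri (of_int (a - 1)) m (n - 1)"
      proof (cases "n = 0")
        case True
        then show ?thesis by (simp add: assms(2) tri_def)
      next
        case n: False
        show ?thesis using False n by (intro less) auto
      qed
      ultimately show ?thesis
        using assms(3)[of "a - 1" m n] tri_rec[of "of_int (a - 1) :: 'a" m n] step2(2)[of m n]
        by (simp del: of_int_diff) (simp add: algebra_simps)
    qed
  qed
qed

lemma mfls_nth_X_0: "mfls_nth (mfls_X v) 0 = 0"
  by (metis (no_types) lookup_single_eq lookup_zero mfls_X.rep_eq zero_neq_one)

lemma unit_series_in_trinomial:
  "u \<in> V \<Longrightarrow> v \<in> V \<Longrightarrow> (1 + mfls_X u + mfls_X v) \<in> unit_series_in V"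
  by (intro unit_series_in_add unit_series_in_1 power_series_in_X)
     (auto simp: mfls_nth_X_0)

lemma unit_series_in_binomial: "v \<in> V \<Longrightarrow> (1 + mfls_X v) \<in> unit_series_in V"
  by (intro unit_series_in_add unit_series_in_1 power_series_in_X)
     (auto simp: mfls_nth_X_0)

lemma mi_le_0_two_singles:
  assumes "u \<noteq> v"
  shows "mi_le 0 (sgl u m + sgl v n) \<longleftrightarrow> 0 \<le> m \<and> 0 \<le> n"
proof
  assume l: "mi_le 0 (sgl u m + sgl v n)"
  show "0 \<le> m \<and> 0 \<le> n"
    using mi_leD[OF l, of u] mi_leD[OF l, of v] assms by (auto simp: lookup_add lookup_single when_def)
qed (auto simp: mi_le_def lookup_add lookup_single when_def)

lemma two_singles_eq_0:
  assumes "u \<noteq> v"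
  shows "sgl u m + sgl v n = 0 \<longleftrightarrow> m = 0 \<and> (n::int) = 0"
proof
  assume "sgl u m + sgl v n = 0"
  then have "lkp (sgl u m + sgl v n) u = 0" "lkp (sgl u m + sgl v n) v = 0" by simp_all
  then show "m = 0 \<and> n = 0" using assms by (auto simp: lookup_add lookup_single when_def)
qed simp

text \<open>\<open>trinom\<close> is defined with the variables \<open>False\<close> and
  \<open>True\<close>. Allowing any two distinct variables transports its value to
  \<open>VX j\<close> and \<open>VY j\<close>.\<close>

lemma mfls_nth_trinomial_tri:
  fixes u v :: 'v
  assumes "u \<noteq> v"
  shows "mfls_nth ((1 + mfls_X u + mfls_X v) powi a) (sgl u m + sgl v n)
    = (tri (of_int a) m n :: 'a::field_char_0)"
proof -
  let ?D = "1 + mfls_X u + mfls_X v :: ('v, 'a) mfls"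
  have D: "?D \<in> unit_series_in {u, v}" by (intro unit_series_in_trinomial) auto
  show ?thesis
  proof (rule trinomial_recursion_unique[of "\<lambda>a m n. mfls_nth (?D powi a) (sgl u m + sgl v n)"])
    show "mfls_nth (?D powi 0) (sgl u m + sgl v n) = (if m = 0 \<and> n = 0 then 1 else 0)" for m n
      by (simp add: mfls_nth_1 two_singles_eq_0[OF assms])
    show "mfls_nth (?D powi a) (sgl u m + sgl v n) = 0" if "m < 0 \<or> n < 0" for a m n
      using power_series_inD(2)[OF unit_series_in_power_series[OF unit_series_in_powi[OF D]]]
        that mi_le_0_two_singles[OF assms, of m n] by fastforce
    fix a m n :: int
    have "sgl u m + sgl v n - sgl u 1 = sgl u (m - 1) + sgl v n"
      "sgl u m + sgl v n - sgl v 1 = sgl u m + sgl v (n - 1)"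
      by (rule poly_mapping_eqI, use assms in \<open>auto simp: lookup_add lookup_minus lookup_single when_def\<close>)+
    moreover have "?D powi (a + 1) = ?D powi a + mfls_X u * ?D powi a + mfls_X v * ?D powi a"
      unfolding mfls_powi_Suc[OF unit_series_in_unit[OF D]] by (simp add: distrib_left distrib_right mult.commute)
    ultimately show "mfls_nth (?D powi (a + 1)) (sgl u m + sgl v n)
        = mfls_nth (?D powi a) (sgl u m + sgl v n) + mfls_nth (?D powi a) (sgl u (m - 1) + sgl v n)
        + mfls_nth (?D powi a) (sgl u m + sgl v (n - 1))"
      by (simp only: mfls_X_eq_mono mfls_nth_mono_mult mfls_nth_add)
  qed
qed

lemma trinom_eq_tri: "trinom a m n = tri (of_int a) m n"
  unfolding trinom_def by (rule mfls_nth_trinomial_tri) simp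

lemma mfls_nth_trinomial:
  "u \<noteq> v \<Longrightarrow> mfls_nth ((1 + mfls_X u + mfls_X v) powi a) (sgl u m + sgl v n) = trinom a m n"
  by (simp add: mfls_nth_trinomial_tri trinom_eq_tri)

lemma trinom_neg: "m < 0 \<or> n < 0 \<Longrightarrow> trinom a m n = 0"
  by (auto simp: trinom_eq_tri tri_def)

lemma trinom_0: "trinom 0 m n = (if m = 0 \<and> n = 0 then 1 else 0)"
  by (simp add: trinom_eq_tri tri_0)

lemma gbinomial_absorb_neg:
  fixes a :: "'a::field_char_0"
  shows "a * ((- a - 1) gchoose k) = - of_nat (Suc k) * ((- a) gchoose Suc k)"
  using gbinomial_absorption[of k "- a"] by (simp del: of_nat_Suc)

text \<open>Coefficient form of \<open>d/dx (1+x+y)^(-a) = -a (1+x+y)^(-a-1)\<close>. It turns the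
  shifted factor \<open>i = j\<close> of the \<F>-type products into a multiple of the unshifted
  one.\<close>

lemma trinom_absorb_left:
  "of_int a * trinom (- a - 1) (m - 1) n = - of_int m * (trinom (- a) m n :: 'a::field_char_0)"
proof (cases "m \<le> 0 \<or> n < 0")
  case True
  then show ?thesis by (cases "m = 0") (auto simp: trinom_neg)
next
  case False
  define i j where "i = nat (m - 1)" and "j = nat n"
  have mn: "m = int (Suc i)" "n = int j" "m - 1 = int i" using False by (auto simp: i_def j_def)
  have "of_nat (Suc i) * of_nat (Suc (i + j) choose Suc i)
      = (of_nat (Suc (i + j)) * of_nat ((i + j) choose i) :: 'a)"
    using Suc_times_binomial[of i "i + j"] by (simp flip: of_nat_mult del: of_nat_Suc mult_Suc binomial_Suc_Suc)
  moreover have "of_int a * ((- of_int a - 1) gchoose (i + j))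
      = - of_nat (Suc (i + j)) * (- of_int a gchoose Suc (i + j) :: 'a)"
    by (rule gbinomial_absorb_neg)
  ultimately have "(of_int a * ((- of_int a - 1) gchoose (i + j))) * of_nat ((i + j) choose i)
      = - (- of_int a gchoose Suc (i + j)) * (of_nat (Suc i) * (of_nat (Suc (i + j) choose Suc i) :: 'a))"
    by (simp only: mult_ac mult_minus_left mult_minus_right)
  then show ?thesis
    unfolding trinom_eq_tri mn(2,3) unfolding mn(1) tri_nat
    by (simp del: of_nat_Suc binomial_Suc_Suc add: mult_ac)
qed

lemma trinom_commute: "trinom a m n = trinom a n m"
proof -
  have "nat (m + n) choose nat m = nat (m + n) choose nat n" if "m \<ge> 0" "n \<ge> 0"
    using that binomial_symmetric[of "nat m" "nat (m + n)"] by (simp add: nat_add_distrib)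
  then show ?thesis by (auto simp: trinom_eq_tri tri_def add.commute)
qed

lemma trinom_absorb_right:
  "of_int a * trinom (- a - 1) m (n - 1) = - of_int n * (trinom (- a) m n :: 'a::field_char_0)"
  using trinom_absorb_left[of a n m] by (simp add: trinom_commute)

section \<open>Binomial coefficients in closed form\<close>

definition bin :: "'a::field_char_0 \<Rightarrow> int \<Rightarrow> 'a" where
  "bin a m = (if m < 0 then 0 else a gchoose nat m)"

lemma bin_rec: "bin (a + 1) m = bin a m + bin a (m - 1)"
proof (cases "m \<le> 0")
  case False
  then obtain i where "m = int (Suc i)" by (metis not_le zero_less_imp_eq_int gr0_conv_Suc)
  then show ?thesis by (simp add: bin_def nat_add_distrib gbinomial_Suc_Suc)
qed (auto simp: bin_def)

text \<open>Used twice: \<open>binom\<close> lives in univariate Laurent series, the generating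
  series in several variables. The recursion determines both and so identifies them.\<close>

lemma binomial_recursion_unique:
  fixes T :: "int \<Rightarrow> int \<Rightarrow> 'a::field_char_0"
  assumes "\<And>m. T 0 m = (if m = 0 then 1 else 0)"
    and "\<And>a m. m < 0 \<Longrightarrow> T a m = 0"
    and "\<And>a m. T (a + 1) m = T a m + T a (m - 1)"
  shows "T a m = bin (of_int a) m"
proof (induction a arbitrary: m rule: int_induct[where k = 0])
  case base
  then show ?case by (auto simp: assms(1) bin_def gbinomial_0_left)
next
  case (step1 a)
  then show ?case by (simp add: assms(3) bin_rec)
next
  case (step2 a)
  show ?case
  proof (induction "nat m" arbitrary: m rule: less_induct)
    case less
    show ?case
    proof (cases "m < 0")
      case False
      have "T (a - 1) (m - 1) = bin (of_int (a - 1)) (m - 1)"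
      proof (cases "m = 0")
        case True
        then show ?thesis by (simp add: assms(2) bin_def)
      next
        case m: False
        show ?thesis using False m by (intro less) auto
      qed
      then show ?thesis
        using assms(3)[of "a - 1" m] bin_rec[of "of_int (a - 1) :: 'a" m] step2(2)[of m]
        by (simp del: of_int_diff) (simp add: algebra_simps)
    qed (simp add: assms(2) bin_def)
  qed
qed

lemma single_eq_0: "sgl v m = 0 \<longleftrightarrow> (m::int) = 0"
  by (metis lookup_single_eq lookup_zero single_zero)

lemma mfls_nth_binomial_bin:
  fixes v :: 'v
  shows "mfls_nth ((1 + mfls_X v) powi a) (sgl v m) = (bin (of_int a) m :: 'a::field_char_0)"
proof -
  let ?D = "1 + mfls_X v :: ('v, 'a) mfls"
  have D: "?D \<in> unit_series_in {v}" by (intro unit_series_in_binomial) auto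
  show ?thesis
  proof (rule binomial_recursion_unique[of "\<lambda>a m. mfls_nth (?D powi a) (sgl v m)"])
    show "mfls_nth (?D powi 0) (sgl v m) = (if m = 0 then 1 else 0)" for m
      by (simp add: mfls_nth_1 single_eq_0)
    show "mfls_nth (?D powi a) (sgl v m) = 0" if "m < 0" for a m
    proof (rule ccontr)
      assume "\<not> ?thesis"
      from power_series_inD(2)[OF unit_series_in_power_series[OF unit_series_in_powi[OF D]] this]
      show False using that mi_leD[of 0 "sgl v m" v] by simp
    qed
    fix a m
    have "?D powi (a + 1) = ?D powi a + mfls_X v * ?D powi a"
      unfolding mfls_powi_Suc[OF unit_series_in_unit[OF D]] by (simp add: distrib_left distrib_right mult.commute)
    then show "mfls_nth (?D powi (a + 1)) (sgl v m)
        = mfls_nth (?D powi a) (sgl v m) + mfls_nth (?D powi a) (sgl v (m - 1))"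
      by (simp add: mfls_X_eq_mono mfls_nth_mono_mult flip: single_diff)
  qed
qed

lemma fls_X_mult_nth: "fls_nth (fls_X * f) m = fls_nth (f :: 'a::comm_ring_1 fls) (m - 1)"
  by (simp add: fls_X_times_conv_shift)

lemma binom_eq_bin: "binom a m = bin (of_int a) m"
proof (rule binomial_recursion_unique)
  show "binom 0 m = (if m = 0 then 1 else 0 :: 'a)" for m
    by (simp add: binom_def)
  have nz: "1 + fls_X \<noteq> (0 :: 'a fls)"
  proof
    assume "1 + fls_X = (0 :: 'a fls)"
    then have "fls_nth (1 + fls_X) 0 = (0 :: 'a)" by simp
    then show False by simp
  qed
  show "binom (a + 1) m = binom a m + (binom a (m - 1) :: 'a)" for a m
    using nz by (simp add: binom_def power_int_add algebra_simps fls_X_mult_nth)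
  have "fls_subdegree (1 + fls_X :: 'a fls) = 0"
    by (rule fls_subdegree_eqI) auto
  then have deg: "fls_subdegree ((1 + fls_X :: 'a fls) powi a) = 0" for a
    by (simp add: power_int_def fls_subdegree_pow)
  show "binom a m = (0 :: 'a)" if "m < 0" for a m
    unfolding binom_def by (rule fls_eq0_below_subdegree) (use that in \<open>simp only: deg\<close>)
qed

lemma mfls_nth_binomial: "mfls_nth ((1 + mfls_X v) powi a) (sgl v m) = binom a m"
  by (simp add: mfls_nth_binomial_bin binom_eq_bin)

lemma binom_neg: "m < 0 \<Longrightarrow> binom a m = 0"
  by (simp add: binom_eq_bin bin_def)

lemma binom_0_right: "binom a 0 = 1"
  by (simp add: binom_eq_bin bin_def)

text \<open>\<open>m - 1\<close> is a natural number smaller than \<open>m\<close>. This is what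
  makes the base product vanish when a zero \<open>P j\<close> is followed by a positive
  \<open>P (Suc j)\<close>.\<close>

lemma binom_pred_self: "m > 0 \<Longrightarrow> binom (m - 1) m = 0"
  using binomial_gbinomial[of "nat (m - 1)" "nat m"] binomial_eq_0[of "nat (m - 1)" "nat m"]
  by (simp add: binom_eq_bin bin_def of_nat_nat)

lemma binom_absorb:
  "of_int a * binom (a - 1) (m - 1) = of_int m * (binom a m :: 'a::field_char_0)"
proof (cases "m \<le> 0")
  case True
  then show ?thesis by (cases "m = 0") (auto simp: binom_neg)
next
  case False
  then obtain i where "m = int (Suc i)" by (metis not_le zero_less_imp_eq_int gr0_conv_Suc)
  then show ?thesis using gbinomial_absorption[of i "of_int a :: 'a"]
    by (simp add: binom_eq_bin bin_def nat_add_distrib)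
qed

text \<open>With \<open>a = P j + P (Suc j)\<close> and \<open>m = P (Suc j)\<close>, the factor
  \<open>a - m\<close> is \<open>P j\<close>. Together with \<open>binom_absorb\<close> this makes
  the binomials with upper index \<open>a - 1\<close> multiples of \<open>binom a m\<close>.\<close>

lemma binom_absorb_comp:
  "of_int a * binom (a - 1) m = of_int (a - m) * (binom a m :: 'a::field_char_0)"
proof (cases "m < 0")
  case False
  then show ?thesis using gbinomial_absorb_comp[of "of_int a :: 'a" "nat m"]
    by (simp add: binom_eq_bin bin_def)
qed (simp add: binom_neg)

section \<open>The sums over one block\<close>

text \<open>
  For one block of variables and \<open>q' = 0\<close>. The index of \<open>P\<close> is shifted by one against the paper:
  \<open>P j\<close> is \<open>p\<^bsub>j-1\<^esub>\<close>. The pair \<open>(e, f)\<close> is \<open>(1, 0)\<close> for \<open>\<F>\<close> and \<open>(0, 1)\<close> for \<open>\<G>\<close>, and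
  \<open>block_base\<close> is the term \<open>i = -1\<close> of \<open>\<F>\<close>.
\<close>

definition block_base :: "nat \<Rightarrow> (nat \<Rightarrow> int) \<Rightarrow> (nat \<Rightarrow> int) \<Rightarrow> (nat \<Rightarrow> int) \<Rightarrow> 'a::field_char_0" where
  "block_base r P m n = (\<Prod>j<r. trinom (- (P j + P (Suc j))) (m j) (n j)
     * binom (P j + P (Suc j) - 1) (P (Suc j)))"

definition block_term ::
  "int \<Rightarrow> int \<Rightarrow> nat \<Rightarrow> (nat \<Rightarrow> int) \<Rightarrow> (nat \<Rightarrow> int) \<Rightarrow> (nat \<Rightarrow> int) \<Rightarrow> nat \<Rightarrow> 'a::field_char_0" where
  "block_term e f r P m n i = (\<Prod>j<r.
     trinom (- (P j + P (Suc j)) - (if i = j then 1 else 0))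
       (m j - (if i = j then e else 0)) (n j - (if i = j then f else 0))
     * binom (P j + P (Suc j) + (if i = j then 1 else 0) - 1)
       (P (Suc j) - (if i \<le> j then 0 else 1)))"

definition block_sum ::
  "int \<Rightarrow> int \<Rightarrow> nat \<Rightarrow> (nat \<Rightarrow> int) \<Rightarrow> (nat \<Rightarrow> int) \<Rightarrow> (nat \<Rightarrow> int) \<Rightarrow> 'a::field_char_0" where
  "block_sum e f r P m n = (\<Sum>i<r. block_term e f r P m n i)"

lemma block_base_Suc:
  "block_base (Suc r) P m n = trinom (- (P 0 + P 1)) (m 0) (n 0) * binom (P 0 + P 1 - 1) (P 1)
     * block_base r (P \<circ> Suc) (m \<circ> Suc) (n \<circ> Suc)"
  by (simp add: block_base_def prod.lessThan_Suc_shift del: prod.lessThan_Suc)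

text \<open>The term \<open>i = 0\<close> changes only the factor \<open>j = 0\<close>. Every later
  term lowers the index of the binomial in that factor, since sigma is \<open>1\<close> there, and
  otherwise is a term of the tail.\<close>

lemma block_sum_Suc:
  "(block_sum e f (Suc r) P m n :: 'a::field_char_0) =
     trinom (- (P 0 + P 1) - 1) (m 0 - e) (n 0 - f) * binom (P 0 + P 1) (P 1)
       * block_base r (P \<circ> Suc) (m \<circ> Suc) (n \<circ> Suc)
     + trinom (- (P 0 + P 1)) (m 0) (n 0) * binom (P 0 + P 1 - 1) (P 1 - 1)
       * block_sum e f r (P \<circ> Suc) (m \<circ> Suc) (n \<circ> Suc)"
proof -
  have "(block_term e f (Suc r) P m n 0 :: 'a) =
     trinom (- (P 0 + P 1) - 1) (m 0 - e) (n 0 - f) * binom (P 0 + P 1) (P 1)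
       * block_base r (P \<circ> Suc) (m \<circ> Suc) (n \<circ> Suc)"
    by (simp add: block_term_def block_base_def prod.lessThan_Suc_shift del: prod.lessThan_Suc)
  moreover have "(block_term e f (Suc r) P m n (Suc i) :: 'a) =
     trinom (- (P 0 + P 1)) (m 0) (n 0) * binom (P 0 + P 1 - 1) (P 1 - 1)
       * block_term e f r (P \<circ> Suc) (m \<circ> Suc) (n \<circ> Suc) i" for i
    by (simp add: block_term_def prod.lessThan_Suc_shift del: prod.lessThan_Suc)
  ultimately show ?thesis
    unfolding block_sum_def by (simp only: sum.lessThan_Suc_shift sum_distrib_left)
qed

text \<open>Zeros propagate from left to right: if \<open>P 0 = 0\<close>, a positive
  \<open>P 1\<close> gives a vanishing binomial, and \<open>P 1 = 0\<close> gives a trinomial with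
  upper index \<open>0\<close>, which is a Kronecker delta.\<close>

lemma block_base_degenerate:
  assumes "P 0 = 0" "P r = 0" "\<And>j. P j \<ge> 0"
  shows "block_base r P m n
    = (if \<forall>j<r. P j = 0 \<and> m j = 0 \<and> n j = 0 then 1 else 0 :: 'a::field_char_0)"
  using assms
proof (induction r arbitrary: P m n)
  case 0
  then show ?case by (simp add: block_base_def)
next
  case (Suc r)
  show ?case
  proof (cases "P 1 = 0")
    case True
    have IH: "block_base r (P \<circ> Suc) (m \<circ> Suc) (n \<circ> Suc)
      = (if \<forall>j<r. (P \<circ> Suc) j = 0 \<and> (m \<circ> Suc) j = 0 \<and> (n \<circ> Suc) j = 0 then 1 else 0 :: 'a)"
      using True Suc.prems by (intro Suc.IH) auto
    have "(\<forall>j<Suc r. P j = 0 \<and> m j = 0 \<and> n j = 0)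
      \<longleftrightarrow> m 0 = 0 \<and> n 0 = 0 \<and> (\<forall>j<r. P (Suc j) = 0 \<and> m (Suc j) = 0 \<and> n (Suc j) = 0)"
      using Suc.prems(1) less_Suc_eq_0_disj by auto
    then show ?thesis
      using True Suc.prems(1)
      unfolding block_base_Suc IH by (simp add: trinom_0 binom_0_right)
  next
    case False
    then have "P 1 > 0" using Suc.prems(3)[of 1] by simp
    \<comment> \<open>This puts the index \<open>1\<close> within the range of the quantifier, so
      that the right-hand side is \<open>0\<close> as well.\<close>
    moreover from False have "r > 0" using Suc.prems(2) by (cases r) auto
    ultimately show ?thesis
      using False Suc.prems(1) by (auto simp: block_base_Suc binom_pred_self)
  qed
qed

text \<open>
  If no \<open>P j + P (Suc j)\<close> vanishes, all summands are the same product up to a factor: \<open>P 0\<close> for the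
  base term, \<open>- m i\<close> and \<open>- n i\<close> for the others.
\<close>

lemma block_sums_proportional:
  assumes "P 0 > 0" "P r = 0" "\<And>j. P j \<ge> 0"
  shows "\<exists>K. block_base r P m n = K * (of_int (P 0) :: 'a::field_char_0)
    \<and> block_sum 1 0 r P m n = - K * of_int (\<Sum>j<r. m j)
    \<and> block_sum 0 1 r P m n = - K * of_int (\<Sum>j<r. n j)"
  using assms
proof (induction r arbitrary: P m n)
  case 0
  then show ?case by simp
next
  case (Suc r)
  let ?N = "block_base r (P \<circ> Suc) (m \<circ> Suc) (n \<circ> Suc) :: 'a"
  define a where "a = P 0 + P 1"
  define c p A T B where "c = (of_int (P 0) :: 'a)" and "p = (of_int (P 1) :: 'a)"
    and "A = (of_int a :: 'a)" and "T = (trinom (- a) (m 0) (n 0) :: 'a)" and "B = (binom a (P 1) :: 'a)"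
  \<comment> \<open>Absorption divides by \<open>a\<close>. Positivity of \<open>P 0\<close> passes
    on to the tail exactly when \<open>P 1\<close> is nonzero, which explains the case distinction
    below.\<close>
  have "a > 0" using Suc.prems(1) Suc.prems(3)[of 1] by (simp add: a_def)
  then have "A \<noteq> 0" by (simp add: A_def)
  moreover have "A = c + p" by (simp add: A_def c_def p_def a_def)
  ultimately have A: "A \<noteq> 0" "A = c + p" by blast+
  have TB: "trinom (- a - 1) (m 0 - 1) (n 0) = - of_int (m 0) * T / A"
    "trinom (- a - 1) (m 0) (n 0 - 1) = - of_int (n 0) * T / A"
    "binom (a - 1) (P 1) = c * B / A" "binom (a - 1) (P 1 - 1) = p * B / A"
    using trinom_absorb_left[of a "m 0" "n 0", where 'a = 'a] trinom_absorb_right[of a "m 0" "n 0", where 'a = 'a]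
      binom_absorb[of a "P 1", where 'a = 'a] binom_absorb_comp[of a "P 1", where 'a = 'a] A(1)
    by (simp_all add: A_def T_def B_def c_def p_def a_def field_simps)
  have sums: "(\<Sum>j<Suc r. x j) = x 0 + (\<Sum>j<r. (x \<circ> Suc) j)" for x :: "nat \<Rightarrow> int"
    by (simp add: sum.lessThan_Suc_shift del: sum.lessThan_Suc)
  show ?case
  proof (cases "P 1 = 0")
    case True
    \<comment> \<open>A degenerate tail is nonzero only if all its exponents vanish. So
      \<open>?N\<close> kills their sums, and \<open>m 0\<close> and \<open>n 0\<close> alone stand
      for the totals.\<close>
    have N: "?N * of_int (\<Sum>j<r. (m \<circ> Suc) j) = 0" "?N * of_int (\<Sum>j<r. (n \<circ> Suc) j) = 0"
      using True Suc.prems by (subst block_base_degenerate; auto)+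
    have "p = 0" using True by (simp add: p_def)
    show ?thesis
    proof (intro exI[of _ "T * B / A * ?N"] conjI)
      show "block_base (Suc r) P m n = T * B / A * ?N * of_int (P 0)"
        unfolding block_base_Suc a_def [symmetric] TB by (simp add: T_def c_def)
      have "block_sum 1 0 (Suc r) P m n = - of_int (m 0) * T / A * B * ?N"
        unfolding block_sum_Suc a_def [symmetric] diff_zero TB using \<open>p = 0\<close> by (simp add: B_def)
      then show "block_sum 1 0 (Suc r) P m n = - (T * B / A * ?N) * of_int (\<Sum>j<Suc r. m j)"
        unfolding sums of_int_add using N(1) by (simp add: algebra_simps)
      have "block_sum 0 1 (Suc r) P m n = - of_int (n 0) * T / A * B * ?N"
        unfolding block_sum_Suc a_def [symmetric] diff_zero TB using \<open>p = 0\<close> by (simp add: B_def)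
      then show "block_sum 0 1 (Suc r) P m n = - (T * B / A * ?N) * of_int (\<Sum>j<Suc r. n j)"
        unfolding sums of_int_add using N(2) by (simp add: algebra_simps)
    qed
  next
    case False
    have prems: "(P \<circ> Suc) 0 > 0" "(P \<circ> Suc) r = 0" "(P \<circ> Suc) j \<ge> 0" for j
      using False Suc.prems by (auto simp: less_le)
    have p: "of_int ((P \<circ> Suc) 0) = p" by (simp add: p_def)
    obtain K where
      K: "?N = K * p"
      "block_sum 1 0 r (P \<circ> Suc) (m \<circ> Suc) (n \<circ> Suc) = - K * of_int (\<Sum>j<r. (m \<circ> Suc) j)"
      "block_sum 0 1 r (P \<circ> Suc) (m \<circ> Suc) (n \<circ> Suc) = - K * of_int (\<Sum>j<r. (n \<circ> Suc) j)"
      using Suc.IH[OF prems, of "m \<circ> Suc" "n \<circ> Suc"] unfolding p by blast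
    show ?thesis
    \<comment> \<open>The factor \<open>p\<close> has two sources: \<open>?N = K * p\<close> in the
      base term and in the term \<open>i = 0\<close>, and absorption in
      \<open>binom (a - 1) (P 1 - 1)\<close> in the later terms. Their agreement lets the sums
      combine.\<close>
    proof (intro exI[of _ "T * B * p / A * K"] conjI)
      show "block_base (Suc r) P m n = T * B * p / A * K * of_int (P 0)"
        unfolding block_base_Suc a_def [symmetric] TB K by (simp add: T_def c_def)
      show "block_sum 1 0 (Suc r) P m n = - (T * B * p / A * K) * of_int (\<Sum>j<Suc r. m j)"
        unfolding block_sum_Suc a_def [symmetric] diff_zero TB K sums of_int_add
        unfolding T_def [symmetric] B_def [symmetric] by (simp add: algebra_simps)
      show "block_sum 0 1 (Suc r) P m n = - (T * B * p / A * K) * of_int (\<Sum>j<Suc r. n j)"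
        unfolding block_sum_Suc a_def [symmetric] diff_zero TB K sums of_int_add
        unfolding T_def [symmetric] B_def [symmetric] by (simp add: algebra_simps)
    qed
  qed
qed

lemma block_term_neg:
  assumes "i < r" "m i < e \<or> n i < f"
  shows "block_term e f r P m n i = 0"
  unfolding block_term_def using assms by (intro prod_zero bexI[of _ i]) (auto simp: trinom_neg)

text \<open>If a total such as \<open>|m|\<close> is zero, every term has a negative lower index.
  This serves the cases of \<open>two_block_identity\<close> in which \<open>P 0\<close> or
  \<open>Pt 0\<close> is zero.\<close>

lemma block_sum_zero:
  assumes "\<And>i. i < r \<Longrightarrow> m i < e \<or> n i < f"
  shows "block_sum e f r P m n = 0"
  unfolding block_sum_def using assms by (simp add: block_term_neg)

text \<open>For positive \<open>P 0\<close> and \<open>Pt 0\<close> the totals cancel. If only one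
  of them is zero, the two totals composing it vanish, which removes the product of the
  \<open>block_sum 0 1\<close> terms; the other product then needs an argument of its own.\<close>

lemma two_block_identity:
  fixes P m n Pt mt nt :: "nat \<Rightarrow> int"
  assumes P: "P 0 = (\<Sum>j<r. m j) + (\<Sum>j<rt. nt j)" "P r = 0" "\<And>j. P j \<ge> 0"
    and Pt: "Pt 0 = (\<Sum>j<rt. mt j) + (\<Sum>j<r. n j)" "Pt rt = 0" "\<And>j. Pt j \<ge> 0"
    and nonneg: "\<And>j. m j \<ge> 0" "\<And>j. n j \<ge> 0" "\<And>j. mt j \<ge> 0" "\<And>j. nt j \<ge> 0"
  shows "(block_base r P m n + block_sum 1 0 r P m n) * (block_base rt Pt mt nt + block_sum 1 0 rt Pt mt nt)
      - block_sum 0 1 r P m n * block_sum 0 1 rt Pt mt nt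
    = (if (\<forall>j<r. P j = 0 \<and> m j = 0 \<and> n j = 0) \<and> (\<forall>j<rt. Pt j = 0 \<and> mt j = 0 \<and> nt j = 0)
       then 1 else 0 :: 'a::field_char_0)"
proof -
  define M N Mt Nt where "M = (\<Sum>j<r. m j)" and "N = (\<Sum>j<r. n j)"
    and "Mt = (\<Sum>j<rt. mt j)" and "Nt = (\<Sum>j<rt. nt j)"
  note sum_defs = M_def N_def Mt_def Nt_def
  have ge: "M \<ge> 0" "N \<ge> 0" "Mt \<ge> 0" "Nt \<ge> 0"
    using nonneg by (auto simp: sum_defs intro: sum_nonneg)
  have eq0: "M = 0 \<longleftrightarrow> (\<forall>j<r. m j = 0)" "N = 0 \<longleftrightarrow> (\<forall>j<r. n j = 0)"
    "Mt = 0 \<longleftrightarrow> (\<forall>j<rt. mt j = 0)" "Nt = 0 \<longleftrightarrow> (\<forall>j<rt. nt j = 0)"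
    unfolding sum_defs using nonneg by (subst sum_nonneg_eq_0_iff; auto)+
  have P0: "P 0 = M + Nt" "Pt 0 = Mt + N" using P(1) Pt(1) by (simp_all add: sum_defs)
  have d: "block_base r P m n = (if \<forall>j<r. P j = 0 \<and> m j = 0 \<and> n j = 0 then 1 else 0 :: 'a)" 
    if "P 0 = 0" using that P by (intro block_base_degenerate) auto
  have dt: "block_base rt Pt mt nt = (if \<forall>j<rt. Pt j = 0 \<and> mt j = 0 \<and> nt j = 0 then 1 else 0 :: 'a)" 
    if "Pt 0 = 0" using that Pt by (intro block_base_degenerate) auto
  have k: "\<exists>K. block_base r P m n = K * (of_int (M + Nt) :: 'a)
    \<and> block_sum 1 0 r P m n = - K * of_int M \<and> block_sum 0 1 r P m n = - K * of_int N" if "P 0 > 0"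
    using block_sums_proportional[of P r m n, where 'a = 'a] that P by (simp add: P0 sum_defs)
  have kt: "\<exists>K. block_base rt Pt mt nt = K * (of_int (Mt + N) :: 'a)
    \<and> block_sum 1 0 rt Pt mt nt = - K * of_int Mt \<and> block_sum 0 1 rt Pt mt nt = - K * of_int Nt" if "Pt 0 > 0"
    using block_sums_proportional[of Pt rt mt nt, where 'a = 'a] that Pt by (simp add: P0 sum_defs)
  have z: "block_sum 1 0 r P m n = (0 :: 'a)" if "M = 0"
    using that eq0(1) by (intro block_sum_zero) auto
  have zn: "block_sum 0 1 r P m n = (0 :: 'a)" if "N = 0"
    using that eq0(2) by (intro block_sum_zero) auto
  have zt: "block_sum 1 0 rt Pt mt nt = (0 :: 'a)" if "Mt = 0"
    using that eq0(3) by (intro block_sum_zero) auto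
  have ztn: "block_sum 0 1 rt Pt mt nt = (0 :: 'a)" if "Nt = 0"
    using that eq0(4) by (intro block_sum_zero) auto
  consider "P 0 > 0" "Pt 0 > 0" | "P 0 = 0" "Pt 0 = 0" | "P 0 = 0" "Pt 0 > 0" | "P 0 > 0" "Pt 0 = 0"
    using P(3)[of 0] Pt(3)[of 0] by fastforce
  then show ?thesis
  proof cases
    case 1
    obtain K where K: "block_base r P m n = K * (of_int (M + Nt) :: 'a)"
      "block_sum 1 0 r P m n = - K * of_int M" "block_sum 0 1 r P m n = - K * of_int N"
      using k[OF 1(1)] by blast
    obtain L where L: "block_base rt Pt mt nt = L * (of_int (Mt + N) :: 'a)"
      "block_sum 1 0 rt Pt mt nt = - L * of_int Mt" "block_sum 0 1 rt Pt mt nt = - L * of_int Nt"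
      using kt[OF 1(2)] by blast
    have "r > 0" using P(2) 1(1) by (cases r) auto
    then have "\<not> (\<forall>j<r. P j = 0 \<and> m j = 0 \<and> n j = 0)" using 1(1) by force
    then show ?thesis unfolding K L by (simp add: algebra_simps)
  next
    case 2
    then have "M = 0" "N = 0" "Mt = 0" "Nt = 0" using P0 ge by auto
    then show ?thesis using d[OF 2(1)] dt[OF 2(2)] z zn zt by simp
  next
    case 3
    then have M: "M = 0" "Nt = 0" using P0 ge by auto
    obtain L where L: "block_base rt Pt mt nt = L * (of_int (Mt + N) :: 'a)"
      "block_sum 1 0 rt Pt mt nt = - L * of_int Mt"
      using kt[OF 3(2)] by blast
    have "rt > 0" using Pt(2) 3(2) by (cases rt) auto
    then have no: "\<not> (\<forall>j<rt. Pt j = 0 \<and> mt j = 0 \<and> nt j = 0)" using 3(2) by force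
    \<comment> \<open>What remains is \<open>block_base r P m n * L * N\<close>: either
      \<open>N\<close> is zero, or a nonzero \<open>n j\<close> annihilates the degenerate base
      product.\<close>
    show ?thesis
    proof (cases "N = 0")
      case True
      then show ?thesis using no by (simp add: z[OF M(1)] ztn[OF M(2)] L)
    next
      case False
      then have "block_base r P m n = (0 :: 'a)" using d[OF 3(1)] eq0(2) by auto
      then show ?thesis using no by (simp add: z[OF M(1)] ztn[OF M(2)])
    qed
  next
    case 4
    then have M: "Mt = 0" "N = 0" using P0 ge by auto
    obtain K where K: "block_base r P m n = K * (of_int (M + Nt) :: 'a)"
      "block_sum 1 0 r P m n = - K * of_int M"
      using k[OF 4(1)] by blast
    have "r > 0" using P(2) 4(1) by (cases r) auto
    then have no: "\<not> (\<forall>j<r. P j = 0 \<and> m j = 0 \<and> n j = 0)" using 4(1) by force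
    show ?thesis
    proof (cases "Nt = 0")
      case True
      then show ?thesis using no by (simp add: zt[OF M(1)] zn[OF M(2)] K)
    next
      case False
      then have "block_base rt Pt mt nt = (0 :: 'a)" using dt[OF 4(2)] eq0(4) by auto
      then show ?thesis using no by (simp add: zt[OF M(1)] zn[OF M(2)])
    qed
  qed
qed

section \<open>Generating series of the coefficients\<close>

text \<open>Upper and lower indices are independent here, because the upper ones come from
  \<open>q\<close> and the lower ones from the difference \<open>q - q'\<close>.\<close>

definition block_coeff ::
  "int \<Rightarrow> int \<Rightarrow> nat \<Rightarrow> (nat \<Rightarrow> int) \<Rightarrow> (nat \<Rightarrow> int) \<Rightarrow> (nat \<Rightarrow> int) \<Rightarrow> (nat \<Rightarrow> int) \<Rightarrow> int \<Rightarrow> 'a::field_char_0" where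
  "block_coeff e f r a m n p i = (\<Prod>j<r.
     trinom (- a j - kron i (int j)) (m j - e * kron i (int j)) (n j - f * kron i (int j))
     * binom (a j + kron i (int j) - 1) (p j - sig i (int j)))"

text \<open>The product of the powers \<open>(W j / D j) powi a j\<close>. Numerator and denominator
  are kept apart because they are series in different variables and yield separate
  coefficients.\<close>

definition block_pow :: "nat \<Rightarrow> (nat \<Rightarrow> ('v, 'a::comm_ring_1) mfls) \<Rightarrow> (nat \<Rightarrow> ('v, 'a) mfls) \<Rightarrow> (nat \<Rightarrow> int) \<Rightarrow> ('v, 'a) mfls" where
  "block_pow r D W a = (\<Prod>j<r. D j powi (- a j) * W j powi a j)"

definition tri_series :: "('v \<Rightarrow> ('v, 'a::comm_ring_1) mfls) \<Rightarrow> (nat \<Rightarrow> 'v) \<Rightarrow> (nat \<Rightarrow> 'v) \<Rightarrow> nat \<Rightarrow> ('v, 'a) mfls" where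
  "tri_series \<eta> X Y j = 1 + \<eta> (X j) + \<eta> (Y j)"

definition bin_series :: "nat \<Rightarrow> ('v \<Rightarrow> ('v, 'a::comm_ring_1) mfls) \<Rightarrow> (nat \<Rightarrow> 'v) \<Rightarrow> nat \<Rightarrow> ('v, 'a) mfls" where
  "bin_series r \<eta> Z j = 1 + (if j < r - 1 then \<eta> (Z j) else 0)"

text \<open>The monomial shifts the lower indices by delta and sigma; the two powers shift the upper
  indices \<open>- a j\<close> and \<open>a j\<close> by \<open>- delta\<close> and
  \<open>delta - 1\<close>.\<close>

definition block_jac ::
  "int \<Rightarrow> int \<Rightarrow> nat \<Rightarrow> (nat \<Rightarrow> 'v) \<Rightarrow> (nat \<Rightarrow> 'v) \<Rightarrow> (nat \<Rightarrow> 'v) \<Rightarrow> int \<Rightarrow> ('v, 'a::comm_ring_1) mfls" where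
  "block_jac e f r X Y Z i = (\<Prod>j<r.
     mfls_mono (sgl (X j) (e * kron i (int j)) + sgl (Y j) (f * kron i (int j)) + sgl (Z j) (sig i (int j)))
     * tri_series mfls_X X Y j powi (- kron i (int j)) * bin_series r mfls_X Z j powi (kron i (int j) - 1))"

lemma mfls_1_powi: "(1 :: ('v, 'a::comm_ring_1) mfls) powi n = 1"
  using mfls_inverse_eqI[of "1 :: ('v, 'a) mfls" 1] by (simp add: power_int_def)

lemma power_series_in_mono_series:
  "kys p \<subseteq> V \<Longrightarrow> mi_le 0 p \<Longrightarrow> mfls_mono p \<in> power_series_in V"
  by (simp add: power_series_in_def mfls_nth_mono)

lemma kys_single_subset: "kys (sgl v c) \<subseteq> {v}"
  by simp

lemma mi_le_0_single: "c \<ge> 0 \<Longrightarrow> mi_le 0 (sgl v c)"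
  by (simp add: mi_le_def lookup_single when_def)

lemma power_series_in_mono_single: "c \<ge> 0 \<Longrightarrow> v \<in> V \<Longrightarrow> mfls_mono (sgl v c) \<in> power_series_in V"
  by (intro power_series_in_mono_series mi_le_0_single) auto

lemma unit_series_in_tri_series: "X j \<in> V \<Longrightarrow> Y j \<in> V \<Longrightarrow> tri_series mfls_X X Y j \<in> unit_series_in V"
  by (simp add: tri_series_def unit_series_in_trinomial)

lemma unit_series_in_bin_series: "Z j \<in> V \<or> \<not> j < r - 1 \<Longrightarrow> bin_series r mfls_X Z j \<in> unit_series_in V"
  by (auto simp: bin_series_def unit_series_in_binomial unit_series_in_1)

lemma tri_series_powi_nth:
  assumes "X j \<noteq> Y j"
  shows "mfls_nth (mfls_mono (sgl (X j) e) * mfls_mono (sgl (Y j) f) * tri_series mfls_X X Y j powi a)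
     (sgl (X j) m + sgl (Y j) n) = (trinom a (m - e) (n - f) :: 'a::field_char_0)"
proof -
  have "sgl (X j) m + sgl (Y j) n - (sgl (X j) e + sgl (Y j) f) = sgl (X j) (m - e) + sgl (Y j) (n - f)"
    by (simp only: single_diff add_diff_add)
  then show ?thesis
    unfolding mfls_mono_add [symmetric] mfls_nth_mono_mult tri_series_def
    by (simp only: mfls_nth_trinomial[OF assms])
qed

text \<open>At \<open>j = r - 1\<close> the convention of a zero last \<open>w\<close> makes the
  series \<open>1\<close>; this matches \<open>binom a 0 = 1\<close>, as both \<open>p\<close> and
  sigma are zero there.\<close>

lemma bin_series_powi_nth:
  assumes "j < r" "i \<le> int r - 1" "j = r - 1 \<Longrightarrow> p = 0"
  shows "mfls_nth (mfls_mono (sgl (Z j) (sig i (int j))) * bin_series r mfls_X Z j powi a)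
     (sgl (Z j) p) = (binom a (p - sig i (int j)) :: 'a::field_char_0)"
proof (cases "j < r - 1")
  case True
  then show ?thesis
    by (simp add: bin_series_def mfls_nth_mono_mult mfls_nth_binomial flip: single_diff)
next
  case False
  then have "p = 0" "sig i (int j) = 0" using assms by (auto simp: sig_def)
  then show ?thesis using False
    by (simp add: bin_series_def mfls_mono_0 mfls_1_powi mfls_nth_1 binom_0_right)
qed

lemma kron_nonneg: "kron i j \<ge> 0" and sig_nonneg: "sig i j \<ge> 0"
  by (simp_all add: kron_def sig_def)

text \<open>The coefficient factors over \<open>j\<close>, as the factors involve pairwise disjoint sets of variables.\<close>

lemma block_series_nth:
  fixes X Y Z :: "nat \<Rightarrow> 'v"
  assumes inj: "inj X" "inj Y" "inj Z" and ne: "\<And>j k. X j \<noteq> Y k" "\<And>j k. X j \<noteq> Z k" "\<And>j k. Y j \<noteq> Z k"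
    and i: "i \<le> int r - 1" and p: "p (r - 1) = 0" and ef: "e \<ge> 0" "f \<ge> 0"
  shows "mfls_nth (block_pow r (tri_series mfls_X X Y) (bin_series r mfls_X Z) a * block_jac e f r X Y Z i)
      (\<Sum>j<r. sgl (X j) (m j) + sgl (Y j) (n j) + sgl (Z j) (p j))
    = (block_coeff e f r a m n p i :: 'a::field_char_0)"
proof -
  let ?k = "\<lambda>j. kron i (int j)" and ?s = "\<lambda>j. sig i (int j)"
  let ?D = "tri_series mfls_X X Y :: nat \<Rightarrow> ('v, 'a) mfls" and ?W = "bin_series r mfls_X Z :: nat \<Rightarrow> ('v, 'a) mfls"
  define A where "A j = mfls_mono (sgl (X j) (e * ?k j)) * mfls_mono (sgl (Y j) (f * ?k j))
    * ?D j powi (- a j - ?k j)" for j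
  define B where "B j = mfls_mono (sgl (Z j) (?s j)) * ?W j powi (a j + ?k j - 1)" for j
  have D: "?D j \<in> unit_series_in {X j, Y j}" for j by (rule unit_series_in_tri_series) auto
  have W: "?W j \<in> unit_series_in {Z j}" for j by (rule unit_series_in_bin_series) auto
  have "block_pow r ?D ?W a * block_jac e f r X Y Z i = (\<Prod>j<r. A j * B j)"
    unfolding block_pow_def block_jac_def prod.distrib [symmetric]
  proof (rule prod.cong[OF refl])
    fix j
    have "?D j powi (- a j - ?k j) = ?D j powi (- a j) * ?D j powi (- ?k j)"
      using mfls_powi_add[OF unit_series_in_unit[OF D], of j "- a j" "- ?k j"] by simp
    moreover have "?W j powi (a j + ?k j - 1) = ?W j powi a j * ?W j powi (?k j - 1)"
      using mfls_powi_add[OF unit_series_in_unit[OF W], of j "a j" "?k j - 1"] by (simp add: add_diff_eq)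
    ultimately show "?D j powi (- a j) * ?W j powi a j *
        (mfls_mono (sgl (X j) (e * ?k j) + sgl (Y j) (f * ?k j) + sgl (Z j) (?s j)) *
         ?D j powi (- ?k j) * ?W j powi (?k j - 1)) = A j * B j"
      by (simp only: A_def B_def mfls_mono_add mult_ac)
  qed
  moreover have PA: "A j \<in> power_series_in {X j, Y j}" for j
    unfolding A_def using ef
    by (intro power_series_in_mult power_series_in_mono_single unit_series_in_power_series unit_series_in_powi D)
       (auto simp: kron_nonneg)
  moreover have PB: "B j \<in> power_series_in {Z j}" for j
    unfolding B_def
    by (intro power_series_in_mult power_series_in_mono_single unit_series_in_power_series unit_series_in_powi W)
       (auto simp: sig_nonneg)
  moreover have "mfls_nth (\<Prod>j<r. A j * B j) (\<Sum>j<r. sgl (X j) (m j) + sgl (Y j) (n j) + sgl (Z j) (p j))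
      = (\<Prod>j<r. mfls_nth (A j * B j) (sgl (X j) (m j) + sgl (Y j) (n j) + sgl (Z j) (p j)))"
  proof (rule mfls_nth_prod_disjoint[where V = "\<lambda>j. {X j, Y j, Z j}"])
    fix j
    show "A j * B j \<in> power_series_in {X j, Y j, Z j}"
      by (intro power_series_in_mult power_series_in_mono[OF _ PA] power_series_in_mono[OF _ PB]) auto
    show "kys (sgl (X j) (m j) + sgl (Y j) (n j) + sgl (Z j) (p j)) \<subseteq> {X j, Y j, Z j}"
      using keys_add[of "sgl (X j) (m j) + sgl (Y j) (n j)" "sgl (Z j) (p j)"]
        keys_add[of "sgl (X j) (m j)" "sgl (Y j) (n j)"] kys_single_subset
      by fastforce
  next
    show "disjoint_family_on (\<lambda>j. {X j, Y j, Z j}) {..<r}"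
      using inj ne unfolding disjoint_family_on_def inj_def by (auto dest: sym)
  qed simp
  moreover have "mfls_nth (A j * B j) (sgl (X j) (m j) + sgl (Y j) (n j) + sgl (Z j) (p j))
      = trinom (- a j - ?k j) (m j - e * ?k j) (n j - f * ?k j) * binom (a j + ?k j - 1) (p j - ?s j)"
    if "j < r" for j
  proof -
    have "kys (sgl (X j) (m j) + sgl (Y j) (n j)) \<subseteq> {X j, Y j}"
      using keys_add[of "sgl (X j) (m j)" "sgl (Y j) (n j)"] kys_single_subset by fastforce
    then have "mfls_nth (A j * B j) (sgl (X j) (m j) + sgl (Y j) (n j) + sgl (Z j) (p j))
        = mfls_nth (A j) (sgl (X j) (m j) + sgl (Y j) (n j)) * mfls_nth (B j) (sgl (Z j) (p j))"
      using ne by (intro mfls_nth_mult_disjoint[OF PA PB]) auto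
    then show ?thesis using that i p ne(1)[of j j]
      unfolding A_def B_def by (simp add: tri_series_powi_nth bin_series_powi_nth)
  qed
  ultimately show ?thesis by (simp add: block_coeff_def)
qed

section \<open>The coefficients in terms of the blocks\<close>

lemma prod_int_interval: "(\<Prod>j=0..int r - 1. h j) = (\<Prod>j<r. h (int j))"
  by (rule prod.reindex_bij_witness[of _ int nat]) auto

lemma sum_int_interval: "(\<Sum>j=0..int r - 1. h j) = (\<Sum>j<r. h (int j))"
  by (rule sum.reindex_bij_witness[of _ int nat]) auto

lemma sum_int_interval_minus1: "(\<Sum>j=-1..int r - 1. h j) = h (-1) + (\<Sum>j<r. h (int j))"
proof -
  have "{-1..int r - 1} = insert (-1) {0..int r - 1}" by auto
  then show ?thesis by (simp add: sum_int_interval)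
qed

text \<open>As in \<open>block_base\<close>, the index of \<open>p\<close> is shifted by one.\<close>

definition P_of :: "nat \<Rightarrow> nat \<Rightarrow> var multi_index \<Rightarrow> nat \<Rightarrow> int" where
  "P_of r rt q j = p_of r rt q (int j - 1)"

definition Pt_of :: "nat \<Rightarrow> nat \<Rightarrow> var multi_index \<Rightarrow> nat \<Rightarrow> int" where
  "Pt_of r rt q j = pt_of r rt q (int j - 1)"

text \<open>The exponent of \<open>(1 + w_j) / (1 + s_j + t_j)\<close> in phi^q.\<close>

definition a_of :: "nat \<Rightarrow> nat \<Rightarrow> var multi_index \<Rightarrow> nat \<Rightarrow> int" where
  "a_of r rt q j = P_of r rt q j + P_of r rt q (Suc j)"

definition at_of :: "nat \<Rightarrow> nat \<Rightarrow> var multi_index \<Rightarrow> nat \<Rightarrow> int" where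
  "at_of r rt q j = Pt_of r rt q j + Pt_of r rt q (Suc j)"

lemma m_of_diff: "m_of (q - q') j = m_of q j - m_of q' j" "n_of (q - q') j = n_of q j - n_of q' j"
  "mt_of (q - q') j = mt_of q j - mt_of q' j" "nt_of (q - q') j = nt_of q j - nt_of q' j"
  by (simp_all add: m_of_def n_of_def mt_of_def nt_of_def lookup_minus)

lemma P_of_diff: "P_of r rt (q - q') j = P_of r rt q j - P_of r rt q' j"
  "Pt_of r rt (q - q') j = Pt_of r rt q j - Pt_of r rt q' j"
  by (simp_all add: P_of_def Pt_of_def p_of_def pt_of_def m_of_diff lookup_minus sum_subtractf)

lemma a_of_diff: "a_of r rt (q - q') j = a_of r rt q j - a_of r rt q' j"
  "at_of r rt (q - q') j = at_of r rt q j - at_of r rt q' j"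
  by (simp_all add: a_of_def at_of_def P_of_diff)

lemma P_of_last: "r \<ge> 1 \<Longrightarrow> P_of r rt q r = 0" "rt \<ge> 1 \<Longrightarrow> Pt_of r rt q rt = 0"
  by (simp_all add: P_of_def Pt_of_def p_of_def pt_of_def)

lemma P_of_0:
  "P_of r rt q 0 = (\<Sum>k<r. m_of q (int k)) + (\<Sum>k<rt. nt_of q (int k))"
  "Pt_of r rt q 0 = (\<Sum>k<rt. mt_of q (int k)) + (\<Sum>k<r. n_of q (int k))"
  by (simp_all add: P_of_def Pt_of_def p_of_def pt_of_def sum_int_interval)

abbreviation "coeff_block e f r rt q d \<equiv> block_coeff e f r (a_of r rt q)
    (\<lambda>j. m_of d (int j)) (\<lambda>j. n_of d (int j)) (\<lambda>j. P_of r rt d (Suc j))"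
abbreviation "coeff_blockt e f r rt q d \<equiv> block_coeff e f rt (at_of r rt q)
    (\<lambda>j. mt_of d (int j)) (\<lambda>j. nt_of d (int j)) (\<lambda>j. Pt_of r rt d (Suc j))"

lemma calF_eq_block_coeff:
  "calF r rt q' q i = coeff_block 1 0 r rt q (q - q') i"
  "calG r rt q' q i = coeff_block 0 1 r rt q (q - q') i"
  "calFt r rt q' q i = coeff_blockt 1 0 r rt q (q - q') i"
  "calGt r rt q' q i = coeff_blockt 0 1 r rt q (q - q') i"
  unfolding calF_def calG_def calFt_def calGt_def block_coeff_def prod_int_interval
    a_of_def at_of_def m_of_diff P_of_diff
  by (simp_all add: P_of_def Pt_of_def)

lemma block_coeff_block_base:
  "block_coeff 1 0 r (\<lambda>j. P j + P (Suc j)) m n (\<lambda>j. P (Suc j)) (-1) = block_base r P m n"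
  by (simp add: block_coeff_def block_base_def kron_def sig_def)

lemma block_coeff_block_term:
  "block_coeff e f r (\<lambda>j. P j + P (Suc j)) m n (\<lambda>j. P (Suc j)) (int i) = block_term e f r P m n i"
  unfolding block_coeff_def block_term_def by (rule prod.cong) (auto simp: kron_def sig_def)

lemma mi_le_0_P_of:
  assumes "mi_le 0 q"
  shows "P_of r rt q j \<ge> 0" "Pt_of r rt q j \<ge> 0"
    "m_of q k \<ge> 0" "n_of q k \<ge> 0" "mt_of q k \<ge> 0" "nt_of q k \<ge> 0"
  using mi_leD[OF assms]
  by (auto simp: P_of_def Pt_of_def p_of_def pt_of_def m_of_def n_of_def mt_of_def nt_of_def
      intro!: sum_nonneg add_nonneg_nonneg)

lemma multi_indices_eq_0:
  assumes "q \<in> multi_indices r rt"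
    and "\<And>j. j < r \<Longrightarrow> P_of r rt q j = 0 \<and> m_of q (int j) = 0 \<and> n_of q (int j) = 0"
    and "\<And>j. j < rt \<Longrightarrow> Pt_of r rt q j = 0 \<and> mt_of q (int j) = 0 \<and> nt_of q (int j) = 0"
  shows "q = 0"
proof (rule poly_mapping_eqI)
  fix v
  have "lkp q v = 0" if "v \<in> vars r rt"
  proof (cases v)
    case (VZ k)
    then have "k < r - 1" using that by (auto simp: vars_def)
    then show ?thesis using assms(2)[of "Suc k"] VZ by (auto simp: P_of_def p_of_def split: if_splits)
  next
    case (VZt k)
    then have "k < rt - 1" using that by (auto simp: vars_def)
    then show ?thesis using assms(3)[of "Suc k"] VZt by (auto simp: Pt_of_def pt_of_def split: if_splits)
  qed (use that assms(2,3) in \<open>auto simp: vars_def m_of_def n_of_def mt_of_def nt_of_def\<close>)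
  moreover have "lkp q v = 0" if "v \<notin> vars r rt"
    using that assms(1) in_keys_iff[of v q] by (auto simp: multi_indices_def)
  ultimately show "lkp q v = lkp 0 v" by auto
qed

text \<open>The double sums factor into sums over one block each, the term \<open>-1\<close> being
  \<open>block_base\<close>; the sums over \<open>calG\<close> start at \<open>0\<close> and so lack
  it.\<close>

lemma calH_0:
  assumes "r \<ge> 1" "rt \<ge> 1" "q \<in> multi_indices r rt" "mi_le 0 q"
  shows "calH r rt 0 q = (if q = 0 then 1 else 0 :: 'a::field_char_0)"
proof -
  let ?P = "P_of r rt q" and ?m = "\<lambda>j. m_of q (int j)" and ?n = "\<lambda>j. n_of q (int j)"
  let ?Pt = "Pt_of r rt q" and ?mt = "\<lambda>j. mt_of q (int j)" and ?nt = "\<lambda>j. nt_of q (int j)"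
  have a: "a_of r rt q = (\<lambda>j. ?P j + ?P (Suc j))" "at_of r rt q = (\<lambda>j. ?Pt j + ?Pt (Suc j))"
    by (simp_all add: fun_eq_iff a_of_def at_of_def)
  have "calH r rt 0 q = (block_base r ?P ?m ?n + block_sum 1 0 r ?P ?m ?n)
        * (block_base rt ?Pt ?mt ?nt + block_sum 1 0 rt ?Pt ?mt ?nt)
      - block_sum 0 1 r ?P ?m ?n * (block_sum 0 1 rt ?Pt ?mt ?nt :: 'a)"
    unfolding calH_def sum_product [symmetric]
    unfolding sum_int_interval sum_int_interval_minus1
      calF_eq_block_coeff a diff_zero block_coeff_block_base block_coeff_block_term block_sum_def ..
  also have "\<dots> = (if (\<forall>j<r. ?P j = 0 \<and> ?m j = 0 \<and> ?n j = 0)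
      \<and> (\<forall>j<rt. ?Pt j = 0 \<and> ?mt j = 0 \<and> ?nt j = 0) then 1 else 0)"
    using assms by (intro two_block_identity P_of_0 P_of_last mi_le_0_P_of)
  also have "(\<forall>j<r. ?P j = 0 \<and> ?m j = 0 \<and> ?n j = 0)
      \<and> (\<forall>j<rt. ?Pt j = 0 \<and> ?mt j = 0 \<and> ?nt j = 0) \<longleftrightarrow> q = 0"
  proof
    assume "q = 0"
    then show "(\<forall>j<r. ?P j = 0 \<and> ?m j = 0 \<and> ?n j = 0)
      \<and> (\<forall>j<rt. ?Pt j = 0 \<and> ?mt j = 0 \<and> ?nt j = 0)"
      by (simp add: P_of_def Pt_of_def p_of_def pt_of_def m_of_def n_of_def mt_of_def nt_of_def)
  qed (use multi_indices_eq_0[OF assms(3)] in blast)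
  finally show ?thesis .
qed

section \<open>The powers of phi and the series J\<close>

definition phi_pow :: "nat \<Rightarrow> nat \<Rightarrow> (var \<Rightarrow> (var, 'a::comm_ring_1) mfls) \<Rightarrow> var multi_index \<Rightarrow> (var, 'a) mfls" where
  "phi_pow r rt \<eta> q = block_pow r (tri_series \<eta> VX VY) (bin_series r \<eta> VZ) (a_of r rt q)
     * block_pow rt (tri_series \<eta> VXt VYt) (bin_series rt \<eta> VZt) (at_of r rt q)"

text \<open>The double sums of \<open>calH\<close> with each coefficient replaced by its
  \<open>block_jac\<close>. The result is free of \<open>q\<close> and \<open>q'\<close>, so that
  powers of phi can be multiplied while this factor stays fixed.\<close>

definition jac :: "nat \<Rightarrow> nat \<Rightarrow> (var, 'a::comm_ring_1) mfls" where
  "jac r rt = (\<Sum>i=-1..int r - 1. \<Sum>\<iota>=-1..int rt - 1. block_jac 1 0 r VX VY VZ i * block_jac 1 0 rt VXt VYt VZt \<iota>)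
     - (\<Sum>i=0..int r - 1. \<Sum>\<iota>=0..int rt - 1. block_jac 0 1 r VX VY VZ i * block_jac 0 1 rt VXt VYt VZt \<iota>)"

lemma unit_series_in_block_pow:
  assumes "\<And>j. j < r \<Longrightarrow> D j \<in> unit_series_in V" "\<And>j. j < r \<Longrightarrow> W j \<in> unit_series_in V"
  shows "block_pow r D W a \<in> unit_series_in V"
  unfolding block_pow_def
  by (intro unit_series_in_prod unit_series_in_mult unit_series_in_powi assms) auto

lemma power_series_in_block_jac:
  assumes "\<And>j. j < r \<Longrightarrow> X j \<in> V" "\<And>j. j < r \<Longrightarrow> Y j \<in> V" "\<And>j. j < r - 1 \<Longrightarrow> Z j \<in> V"
    and "e \<ge> 0" "f \<ge> 0" "i \<le> int r - 1"
  shows "block_jac e f r X Y Z i \<in> power_series_in V"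
  unfolding block_jac_def mfls_mono_add
proof (intro power_series_in_prod power_series_in_mult)
  fix j assume "j \<in> {..<r}"
  then have j: "j < r" by simp
  show "mfls_mono (sgl (Z j) (sig i (int j))) \<in> power_series_in V"
  proof (cases "j < r - 1")
    case True
    then show ?thesis using assms by (intro power_series_in_mono_single) (auto simp: sig_nonneg)
  next
    case False
    \<comment> \<open>At \<open>j = r - 1\<close> the symbol \<open>Z j\<close> need not be in
      \<open>V\<close>; its exponent vanishes because \<open>i\<close> is at most
      \<open>r - 1\<close>.\<close>
    then have "sig i (int j) = 0" using j assms(6) by (auto simp: sig_def)
    then show ?thesis by (simp add: mfls_mono_0 power_series_in_1)
  qed
  show "mfls_mono (sgl (X j) (e * kron i (int j))) \<in> power_series_in V"
    "mfls_mono (sgl (Y j) (f * kron i (int j))) \<in> power_series_in V"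
    using j assms by (auto intro!: power_series_in_mono_single simp: kron_nonneg)
  show "tri_series mfls_X X Y j powi n \<in> power_series_in V" for n
    using j assms by (intro unit_series_in_power_series unit_series_in_powi unit_series_in_tri_series)
  show "bin_series r mfls_X Z j powi n \<in> power_series_in V" for n
    using j assms by (intro unit_series_in_power_series unit_series_in_powi unit_series_in_bin_series) blast
qed

lemma in_vars [simp]:
  "VX j \<in> vars r rt \<longleftrightarrow> j < r" "VY j \<in> vars r rt \<longleftrightarrow> j < r" "VZ j \<in> vars r rt \<longleftrightarrow> j < r - 1"
  "VXt j \<in> vars r rt \<longleftrightarrow> j < rt" "VYt j \<in> vars r rt \<longleftrightarrow> j < rt" "VZt j \<in> vars r rt \<longleftrightarrow> j < rt - 1"
  by (auto simp: vars_def)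

lemma power_series_in_jac: "jac r rt \<in> power_series_in (vars r rt)"
  unfolding jac_def
  by (intro power_series_in_diff power_series_in_sum power_series_in_mult power_series_in_block_jac) auto

lemma keys_block_index:
  "kys (\<Sum>j<r. sgl (X j) (m j) + sgl (Y j) (n j) + sgl (Z j) (p j))
     \<subseteq> range X \<union> range Y \<union> range Z"
proof -
  have "kys (sgl (X j) (m j) + sgl (Y j) (n j) + sgl (Z j) (p j)) \<subseteq> range X \<union> range Y \<union> range Z" for j
    using keys_add[of "sgl (X j) (m j) + sgl (Y j) (n j)" "sgl (Z j) (p j)"]
      keys_add[of "sgl (X j) (m j)" "sgl (Y j) (n j)"]
      kys_single_subset[of "X j" "m j"] kys_single_subset[of "Y j" "n j"] kys_single_subset[of "Z j" "p j"]
    by blast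
  then show ?thesis by (intro order_trans[OF keys_sum UN_least])
qed

text \<open>The summands with \<open>VZ (r - 1)\<close> and \<open>VZt (rt - 1)\<close> lie outside
  \<open>vars r rt\<close> but carry exponent zero, so both sums may run over full ranges.\<close>

lemma multi_index_block_sum:
  assumes "r \<ge> 1" "rt \<ge> 1" "d \<in> multi_indices r rt"
  shows "d = (\<Sum>j<r. sgl (VX j) (m_of d (int j)) + sgl (VY j) (n_of d (int j)) + sgl (VZ j) (P_of r rt d (Suc j)))
    + (\<Sum>j<rt. sgl (VXt j) (mt_of d (int j)) + sgl (VYt j) (nt_of d (int j)) + sgl (VZt j) (Pt_of r rt d (Suc j)))"
    (is "d = ?R")
proof (rule poly_mapping_eqI)
  fix v
  have 0: "lkp d v = 0" if "v \<notin> vars r rt"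
    using that assms(3) in_keys_iff[of v d] by (auto simp: multi_indices_def)
  note lkp = lookup_add lookup_sum lookup_single when_def sum.distrib
    m_of_def n_of_def mt_of_def nt_of_def P_of_def Pt_of_def p_of_def pt_of_def
  show "lkp d v = lkp ?R v"
  proof (cases v)
    case (VX k)
    then show ?thesis using 0 by (auto simp: lkp vars_def image_iff)
  next
    case (VY k)
    then show ?thesis using 0 by (auto simp: lkp vars_def image_iff)
  next
    case (VXt k)
    then show ?thesis using 0 by (auto simp: lkp vars_def image_iff)
  next
    case (VYt k)
    then show ?thesis using 0 by (auto simp: lkp vars_def image_iff)
  next
    case (VZ k)
    then have "lkp ?R v = (\<Sum>j<r. if j = k then P_of r rt d (Suc k) else 0)"
      by (simp add: lookup_add lookup_sum lookup_single when_def sum.distrib cong: if_cong)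
    then show ?thesis using 0 VZ assms(1) by (auto simp: P_of_def p_of_def vars_def image_iff)
  next
    case (VZt k)
    then have "lkp ?R v = (\<Sum>j<rt. if j = k then Pt_of r rt d (Suc k) else 0)"
      by (simp add: lookup_add lookup_sum lookup_single when_def sum.distrib cong: if_cong)
    then show ?thesis using 0 VZt assms(2) by (auto simp: Pt_of_def pt_of_def vars_def image_iff)
  qed
qed

text \<open>phi^q and each summand of \<open>jac\<close> split into one factor per block, in
  disjoint variables; each factor has the coefficient given by
  \<open>block_series_nth\<close>.\<close>

lemma calH_eq_nth:
  fixes q q' :: "var multi_index"
  assumes r: "r \<ge> 1" "rt \<ge> 1" and d: "q - q' \<in> multi_indices r rt"
  shows "calH r rt q' q = (mfls_nth (phi_pow r rt mfls_X q * jac r rt) (q - q') :: 'a::field_char_0)"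
proof -
  let ?d = "q - q'"
  let ?d1 = "\<Sum>j<r. sgl (VX j) (m_of ?d (int j)) + sgl (VY j) (n_of ?d (int j)) + sgl (VZ j) (P_of r rt ?d (Suc j))"
  let ?d2 = "\<Sum>j<rt. sgl (VXt j) (mt_of ?d (int j)) + sgl (VYt j) (nt_of ?d (int j)) + sgl (VZt j) (Pt_of r rt ?d (Suc j))"
  let ?U = "range VX \<union> range VY \<union> range VZ" and ?Ut = "range VXt \<union> range VYt \<union> range VZt"
  let ?B = "block_pow r (tri_series mfls_X VX VY) (bin_series r mfls_X VZ) (a_of r rt q) :: (var, 'a) mfls"
  let ?Bt = "block_pow rt (tri_series mfls_X VXt VYt) (bin_series rt mfls_X VZt) (at_of r rt q) :: (var, 'a) mfls"
  have coeff: "mfls_nth ((?B * block_jac e f r VX VY VZ i) * (?Bt * block_jac e f rt VXt VYt VZt \<iota>)) ?d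
      = coeff_block e f r rt q ?d i * coeff_blockt e f r rt q ?d \<iota>"
    if i: "i \<le> int r - 1" "\<iota> \<le> int rt - 1" and ef: "e \<ge> 0" "f \<ge> 0" for e f i \<iota>
  proof -
    have PS: "?B * block_jac e f r VX VY VZ i \<in> power_series_in ?U"
      "?Bt * block_jac e f rt VXt VYt VZt \<iota> \<in> power_series_in ?Ut"
      using i ef by (intro power_series_in_mult power_series_in_block_jac unit_series_in_power_series
          unit_series_in_block_pow unit_series_in_tri_series unit_series_in_bin_series; simp)+
    have last: "P_of r rt ?d (Suc (r - 1)) = 0" "Pt_of r rt ?d (Suc (rt - 1)) = 0"
      using r by (simp_all add: P_of_last)
    have "?U \<inter> ?Ut = {}" by auto
    note split = mfls_nth_mult_disjoint[OF PS this keys_block_index keys_block_index]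
    have U: "mfls_nth (?B * block_jac e f r VX VY VZ i) ?d1 = coeff_block e f r rt q ?d i"
      by (rule block_series_nth) (use i ef last in \<open>simp_all add: inj_def\<close>)
    have Ut: "mfls_nth (?Bt * block_jac e f rt VXt VYt VZt \<iota>) ?d2 = coeff_blockt e f r rt q ?d \<iota>"
      by (rule block_series_nth) (use i ef last in \<open>simp_all add: inj_def\<close>)
    show ?thesis
      using arg_cong[OF multi_index_block_sum[OF r d]] unfolding U [symmetric] Ut [symmetric] split [symmetric] .
  qed
  have "phi_pow r rt mfls_X q * jac r rt =
      (\<Sum>i=-1..int r - 1. \<Sum>\<iota>=-1..int rt - 1.
         (?B * block_jac 1 0 r VX VY VZ i) * (?Bt * block_jac 1 0 rt VXt VYt VZt \<iota>))
      - (\<Sum>i=0..int r - 1. \<Sum>\<iota>=0..int rt - 1.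
         (?B * block_jac 0 1 r VX VY VZ i) * (?Bt * block_jac 0 1 rt VXt VYt VZt \<iota>))"
    unfolding phi_pow_def jac_def right_diff_distrib sum_distrib_left by (simp only: mult_ac)
  then show ?thesis
    unfolding calH_def calF_eq_block_coeff
    by (simp only: mfls_nth_diff mfls_nth_sum) (simp add: coeff)
qed

section \<open>The solution of the implicit system\<close>

definition eta_pow :: "nat \<Rightarrow> nat \<Rightarrow> (var \<Rightarrow> (var, 'a::comm_ring_1) mfls) \<Rightarrow> var multi_index \<Rightarrow> (var, 'a) mfls" where
  "eta_pow r rt \<eta> q = (\<Prod>v\<in>vars r rt. \<eta> v powi lkp q v)"

lemma finite_vars: "finite (vars r rt)"
  by (simp add: vars_def)

lemma prod_vars:
  "(\<Prod>v\<in>vars r rt. g v) = (\<Prod>j<r. g (VX j)) * (\<Prod>j<r. g (VY j)) * (\<Prod>j<r - 1. g (VZ j))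
     * (\<Prod>j<rt. g (VXt j)) * (\<Prod>j<rt. g (VYt j)) * (\<Prod>j<rt - 1. g (VZt j))"
proof -
  have im: "prod g (c ` A) = (\<Prod>j\<in>A. g (c j))" if "inj c" for c :: "nat \<Rightarrow> var" and A
    using that by (simp add: prod.reindex inj_on_subset)
  have "inj VX" "inj VY" "inj VZ" "inj VXt" "inj VYt" "inj VZt" by (simp_all add: inj_def)
  then show ?thesis
    unfolding vars_def by (subst prod.union_disjoint; (auto simp: im)?)+
qed

lemma block_pow_add:
  assumes "\<And>j. j < r \<Longrightarrow> D j dvd 1" "\<And>j. j < r \<Longrightarrow> W j dvd 1"
  shows "block_pow r D W (\<lambda>j. a j + b j) = block_pow r D W a * block_pow r D W b"
  unfolding block_pow_def prod.distrib [symmetric]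
proof (rule prod.cong[OF refl])
  fix j assume "j \<in> {..<r}"
  then have j: "D j dvd 1" "W j dvd 1" using assms by auto
  show "D j powi - (a j + b j) * W j powi (a j + b j)
      = D j powi - a j * W j powi a j * (D j powi - b j * W j powi b j)"
    using mfls_powi_add[OF j(1), of "- a j" "- b j"] mfls_powi_add[OF j(2), of "a j" "b j"]
    by (simp add: mult_ac)
qed

text \<open>With \<open>u\<^sub>j = W j / D j\<close>, the product telescopes: \<open>h\<^sub>j = u\<^sub>j u\<^bsub>j+1\<^esub>\<close>, so that
  \<open>u\<^sub>j\<close> gets the exponent \<open>P j + P (j + 1)\<close>.\<close>

lemma block_pow_eq:
  assumes "\<And>j. j < r \<Longrightarrow> D j dvd 1" "\<And>j. j < r \<Longrightarrow> W j dvd 1" "r \<ge> 1" "P r = 0"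
  shows "block_pow r D W (\<lambda>j. P j + P (Suc j)) = (W 0 * inverse (D 0)) powi P 0
    * (\<Prod>j<r - 1. (W j * W (j + 1) * inverse (D j * D (j + 1))) powi P (Suc j))"
proof -
  define u where "u j = W j * inverse (D j)" for j
  have u: "u j dvd 1" if "j < r" for j
    using that assms by (simp add: u_def mfls_mult_unit mfls_inverse_unit)
  have pow: "D j powi - k * W j powi k = u j powi k" if "j < r" for j k
    using that assms(1,2)[of j]
    by (simp add: u_def mfls_powi_mult_distrib mfls_inverse_unit mfls_inverse_powi mult.commute)
  obtain k where k: "r = Suc k" using assms(3) by (cases r) auto
  have "block_pow r D W (\<lambda>j. P j + P (Suc j)) = (\<Prod>j<r. u j powi P j) * (\<Prod>j<r. u j powi P (Suc j))"
    unfolding block_pow_def prod.distrib [symmetric]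
    by (intro prod.cong refl) (simp only: lessThan_iff pow mfls_powi_add[OF u])
  also have "(\<Prod>j<r. u j powi P j) = u 0 powi P 0 * (\<Prod>j<k. u (Suc j) powi P (Suc j))"
    unfolding k by (rule prod.lessThan_Suc_shift)
  also have "(\<Prod>j<r. u j powi P (Suc j)) = (\<Prod>j<k. u j powi P (Suc j))"
    using assms(4) by (simp add: k)
  also have "u 0 powi P 0 * (\<Prod>j<k. u (Suc j) powi P (Suc j)) * (\<Prod>j<k. u j powi P (Suc j))
      = u 0 powi P 0 * (\<Prod>j<k. (u j * u (Suc j)) powi P (Suc j))"
  proof -
    have "(\<Prod>j<k. (u j * u (Suc j)) powi P (Suc j)) = (\<Prod>j<k. u j powi P (Suc j) * u (Suc j) powi P (Suc j))"
      by (intro prod.cong refl) (simp add: k mfls_powi_mult_distrib u)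
    then show ?thesis by (simp add: prod.distrib mult_ac)
  qed
  also have "(\<Prod>j<k. (u j * u (Suc j)) powi P (Suc j))
      = (\<Prod>j<r - 1. (W j * W (j + 1) * inverse (D j * D (j + 1))) powi P (Suc j))"
  proof (rule prod.cong)
    fix j assume "j \<in> {..<r - 1}"
    then have "u j * u (Suc j) = W j * W (j + 1) * inverse (D j * D (j + 1))"
      using assms(1) by (simp add: u_def mfls_inverse_mult_distrib mult_ac)
    then show "(u j * u (Suc j)) powi P (Suc j)
        = (W j * W (j + 1) * inverse (D j * D (j + 1))) powi P (Suc j)" by simp
  qed (simp add: k)
  finally show ?thesis by (simp add: u_def)
qed

lemma a_of_uminus: "a_of r rt (- q) j = - a_of r rt q j" "at_of r rt (- q) j = - at_of r rt q j"
  using a_of_diff[of r rt 0 q j] a_of_diff[of r rt 0 0 j] by simp_all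

lemma vars_wser:
  "1 + wser r \<eta> j = bin_series r \<eta> VZ j" "1 + wtser rt \<eta> j = bin_series rt \<eta> VZt j"
  by (simp_all add: wser_def wtser_def bin_series_def)

text \<open>The implicit equation is left out, so that the formal variables are an instance too and
  the facts about \<open>phi_pow\<close> hold for phi(X) as well as for phi(eta).\<close>

locale eta_solution =
  fixes r rt :: nat and \<eta> :: "var \<Rightarrow> (var, 'a::comm_ring_1) mfls"
  assumes r: "r \<ge> 1" and rt: "rt \<ge> 1"
    and eta_series: "v \<in> vars r rt \<Longrightarrow> \<eta> v \<in> power_series_in (vars r rt)"
    and eta_nth_0: "v \<in> vars r rt \<Longrightarrow> mfls_nth (\<eta> v) 0 = 0"
begin

lemma unit_tri_series:
  "j < r \<Longrightarrow> tri_series \<eta> VX VY j \<in> unit_series_in (vars r rt)"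
  "j < rt \<Longrightarrow> tri_series \<eta> VXt VYt j \<in> unit_series_in (vars r rt)"
  unfolding tri_series_def
  by (intro unit_series_in_add unit_series_in_1 eta_series eta_nth_0; simp)+

lemma unit_bin_series:
  "bin_series r \<eta> VZ j \<in> unit_series_in (vars r rt)"
  "bin_series rt \<eta> VZt j \<in> unit_series_in (vars r rt)"
  unfolding bin_series_def
  by (auto intro!: unit_series_in_add unit_series_in_1 eta_series eta_nth_0)

lemmas units = unit_tri_series[THEN unit_series_in_unit] unit_bin_series[THEN unit_series_in_unit]

lemma unit_phi_pow: "phi_pow r rt \<eta> q \<in> unit_series_in (vars r rt)"
  unfolding phi_pow_def
  by (intro unit_series_in_mult unit_series_in_block_pow unit_tri_series unit_bin_series)

lemma phi_pow_diff: "phi_pow r rt \<eta> (q - q') = phi_pow r rt \<eta> (- q') * phi_pow r rt \<eta> q"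
proof -
  have "a_of r rt (q - q') = (\<lambda>j. a_of r rt (- q') j + a_of r rt q j)"
    "at_of r rt (q - q') = (\<lambda>j. at_of r rt (- q') j + at_of r rt q j)"
    by (simp_all add: fun_eq_iff a_of_diff a_of_uminus)
  then show ?thesis unfolding phi_pow_def by (simp add: block_pow_add units mult_ac)
qed

lemma phi_pow_0: "phi_pow r rt \<eta> 0 = 1"
proof -
  have "a_of r rt 0 = (\<lambda>j. 0)" "at_of r rt 0 = (\<lambda>j. 0)"
    using a_of_diff[of r rt 0 0] by (simp_all add: fun_eq_iff)
  then show ?thesis by (simp add: phi_pow_def block_pow_def)
qed

lemma unit_phi: "v \<in> vars r rt \<Longrightarrow> phi r rt \<eta> v \<in> unit_series_in (vars r rt)"
  using r rt by (cases v)
    (auto simp: divide_mfls_def vars_wser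
      simp flip: tri_series_def[of \<eta> VX VY] tri_series_def[of \<eta> VXt VYt]
      intro!: unit_series_in_mult unit_series_in_inverse unit_bin_series unit_tri_series)

text \<open>The components at \<open>VX\<close> and \<open>VYt\<close> all equal \<open>?u\<close>,
  so its exponents add up to \<open>|m| + |nt|\<close>, which is the value of p at
  \<open>-1\<close>; likewise for \<open>?ut\<close>. The components at \<open>VZ\<close> and
  \<open>VZt\<close> are absorbed by \<open>block_pow_eq\<close>.\<close>

lemma prod_phi_powi: "(\<Prod>v\<in>vars r rt. phi r rt \<eta> v powi lkp q v) = phi_pow r rt \<eta> q"
proof -
  let ?D = "tri_series \<eta> VX VY" and ?W = "bin_series r \<eta> VZ"
  let ?Dt = "tri_series \<eta> VXt VYt" and ?Wt = "bin_series rt \<eta> VZt"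
  let ?u = "?W 0 * inverse (?D 0)" and ?ut = "?Wt 0 * inverse (?Dt 0)"
  have a: "a_of r rt q = (\<lambda>j. P_of r rt q j + P_of r rt q (Suc j))"
    "at_of r rt q = (\<lambda>j. Pt_of r rt q j + Pt_of r rt q (Suc j))"
    by (simp_all add: fun_eq_iff a_of_def at_of_def)
  have u: "?u dvd 1" "?ut dvd 1" using r rt by (simp_all add: units mfls_mult_unit mfls_inverse_unit)
  have u0: "?u powi P_of r rt q 0 = (\<Prod>j<r. ?u powi lkp q (VX j)) * (\<Prod>j<rt. ?u powi lkp q (VYt j))"
    "?ut powi Pt_of r rt q 0 = (\<Prod>j<rt. ?ut powi lkp q (VXt j)) * (\<Prod>j<r. ?ut powi lkp q (VY j))"
    by (simp_all add: P_of_0 mfls_powi_add[OF u(1)] mfls_powi_add[OF u(2)]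
        mfls_powi_sum[OF u(1)] mfls_powi_sum[OF u(2)] m_of_def n_of_def mt_of_def nt_of_def)
  have P: "P_of r rt q (Suc j) = lkp q (VZ j)" if "j < r - 1" for j
    using that by (simp add: P_of_def p_of_def)
  have Pt: "Pt_of r rt q (Suc j) = lkp q (VZt j)" if "j < rt - 1" for j
    using that by (simp add: Pt_of_def pt_of_def)
  have b: "block_pow r ?D ?W (a_of r rt q) = ?u powi P_of r rt q 0
      * (\<Prod>j<r - 1. (?W j * ?W (j + 1) * inverse (?D j * ?D (j + 1))) powi lkp q (VZ j))"
    unfolding a using r by (subst block_pow_eq) (auto simp: units P_of_last P)
  have bt: "block_pow rt ?Dt ?Wt (at_of r rt q) = ?ut powi Pt_of r rt q 0
      * (\<Prod>j<rt - 1. (?Wt j * ?Wt (j + 1) * inverse (?Dt j * ?Dt (j + 1))) powi lkp q (VZt j))"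
    unfolding a using rt by (subst block_pow_eq) (auto simp: units P_of_last Pt)
  show ?thesis
    unfolding prod_vars phi_pow_def b bt u0 phi.simps vars_wser divide_mfls_def
      tri_series_def [symmetric]
    by (simp only: mult_ac)
qed

end

lemma eta_solution_X: "r \<ge> 1 \<Longrightarrow> rt \<ge> 1 \<Longrightarrow> eta_solution r rt mfls_X"
  by unfold_locales (auto intro: power_series_in_X simp: mfls_nth_X_0)

section \<open>Substitution of the solution\<close>

locale eta_implicit = eta_solution r rt \<eta>
  for r rt :: nat and \<eta> :: "var \<Rightarrow> (var, 'a::field_char_0) mfls" +
  assumes eta_implicit: "v \<in> vars r rt \<Longrightarrow> mfls_X v = \<eta> v / phi r rt \<eta> v"
begin

abbreviation "V \<equiv> vars r rt"
abbreviation "MI \<equiv> multi_indices r rt"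
abbreviation "E \<equiv> eta_pow r rt \<eta>"

interpretation X: eta_solution r rt "mfls_X :: var \<Rightarrow> (var, 'a) mfls"
  by (rule eta_solution_X[OF r rt])

lemma eta_eq: "v \<in> V \<Longrightarrow> \<eta> v = mfls_X v * phi r rt \<eta> v"
proof -
  assume v: "v \<in> V"
  have "mfls_X v * phi r rt \<eta> v = \<eta> v * (phi r rt \<eta> v * inverse (phi r rt \<eta> v))"
    using eta_implicit[OF v] by (simp add: divide_mfls_def mult_ac)
  then show ?thesis by (simp add: mfls_inverse_mult unit_series_in_unit[OF unit_phi[OF v]])
qed

text \<open>A variable times a series with constant term 1 is invertible; this gives negative powers
  of \<open>\<eta> v\<close> their meaning, as \<open>inverse\<close> of a non-unit is
  \<open>0\<close>.\<close>

lemma eta_unit: "v \<in> V \<Longrightarrow> \<eta> v dvd 1"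
  by (subst eta_eq) (simp_all add: mfls_mult_unit mfls_X_eq_mono mfls_mono_unit unit_series_in_unit[OF unit_phi])

lemma eta_pow_eq: "q \<in> MI \<Longrightarrow> E q = mfls_mono q * phi_pow r rt \<eta> q"
proof -
  assume q: "q \<in> MI"
  have "E q = (\<Prod>v\<in>V. mfls_X v powi lkp q v * phi r rt \<eta> v powi lkp q v)"
    unfolding eta_pow_def
  proof (rule prod.cong[OF refl])
    fix v assume v: "v \<in> V"
    have "\<eta> v powi lkp q v = (mfls_X v * phi r rt \<eta> v) powi lkp q v"
      using eta_eq[OF v] by simp
    also have "\<dots> = mfls_X v powi lkp q v * phi r rt \<eta> v powi lkp q v"
      by (intro mfls_powi_mult_distrib unit_series_in_unit[OF unit_phi[OF v]])
         (simp add: mfls_X_eq_mono mfls_mono_unit)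
    finally show "\<eta> v powi lkp q v = mfls_X v powi lkp q v * phi r rt \<eta> v powi lkp q v" .
  qed
  also have "\<dots> = mfls_mono q * phi_pow r rt \<eta> q"
    using q by (simp add: prod.distrib prod_phi_powi mfls_prod_X_powi mi_sum_singles[OF finite_vars] multi_indices_def)
  finally show ?thesis .
qed

lemma eta_pow_nth: "q \<in> MI \<Longrightarrow> mfls_nth (E q) s = mfls_nth (phi_pow r rt \<eta> q) (s - q)"
  by (simp add: eta_pow_eq mfls_nth_mono_mult)

text \<open>The source of triangularity: phi(eta)^q is a power series, so the monomial factor of
  \<open>E q\<close> bounds the support from below.\<close>

lemma eta_pow_support:
  assumes "q \<in> MI" "mfls_nth (E q) s \<noteq> 0"
  shows "s \<in> MI" "mi_le q s"
proof -
  have "mfls_nth (phi_pow r rt \<eta> q) (s - q) \<noteq> 0" using assms by (simp add: eta_pow_nth)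
  from power_series_inD[OF unit_series_in_power_series[OF unit_phi_pow] this]
  have s: "kys (s - q) \<subseteq> V" "mi_le 0 (s - q)" .
  from s(2) show "mi_le q s" by (simp add: mi_le_def lookup_minus)
  have "kys (s - q + q) \<subseteq> V" using keys_add[of "s - q" q] s(1) assms(1) by (auto simp: multi_indices_def)
  then show "s \<in> MI" by (simp add: multi_indices_def)
qed

lemma eta_pow_add: "E (p + q) = E p * E q"
  unfolding eta_pow_def prod.distrib [symmetric]
  by (intro prod.cong refl) (simp add: lookup_add mfls_powi_add eta_unit)

lemma eta_pow_0: "E 0 = 1"
  by (simp add: eta_pow_def)

lemma MI_0: "0 \<in> MI" and MI_add: "p \<in> MI \<Longrightarrow> q \<in> MI \<Longrightarrow> p + q \<in> MI"
  and MI_uminus: "q \<in> MI \<Longrightarrow> - q \<in> MI"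
  using keys_add[of p q] by (auto simp: multi_indices_def)

lemma MI_diff: "p \<in> MI \<Longrightarrow> q \<in> MI \<Longrightarrow> p - q \<in> MI"
  using MI_add[OF _ MI_uminus] by fastforce

section \<open>The substitution homomorphism\<close>

definition below :: "var multi_index \<Rightarrow> var multi_index set" where
  "below q = {p. p \<in> MI \<and> mi_le 0 p \<and> mi_le p q}"

lemma finite_below: "finite (below q)"
  unfolding below_def by (rule finite_subset[OF _ finite_mi_interval[of 0 q]]) blast

text \<open>Composition with eta, coefficient by coefficient. Since \<open>E p\<close> is supported
  above \<open>p\<close>, only the finitely many \<open>p\<close> in \<open>below q\<close> matter.
  Coefficients of \<open>F\<close> outside \<open>MI\<close> or with a negative exponent are
  ignored, so the map is meant for power series in \<open>V\<close>.\<close>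

definition eta_subst :: "(var, 'a) mfls \<Rightarrow> (var, 'a) mfls" where
  "eta_subst F = Abs_mfls (\<lambda>q. \<Sum>p\<in>below q. mfls_nth F p * mfls_nth (E p) q)"

lemma eta_subst_nth: "mfls_nth (eta_subst F) q = (\<Sum>p\<in>below q. mfls_nth F p * mfls_nth (E p) q)"
proof -
  have "mi_le 0 q" if "(\<Sum>p\<in>below q. mfls_nth F p * mfls_nth (E p) q) \<noteq> 0" for q
  proof -
    from that obtain p where "p \<in> below q" by (meson sum.not_neutral_contains_not_neutral)
    then show ?thesis using mi_le_trans by (auto simp: below_def)
  qed
  then have "\<exists>b. \<forall>q. (\<Sum>p\<in>below q. mfls_nth F p * mfls_nth (E p) q) \<noteq> 0 \<longrightarrow> mi_le b q" by blast
  then show ?thesis by (simp add: eta_subst_def Abs_mfls_inverse)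
qed

lemma eta_subst_support: "mfls_nth (eta_subst F) q \<noteq> 0 \<Longrightarrow> mi_le 0 q"
  unfolding eta_subst_nth by (metis (no_types, lifting) below_def mem_Collect_eq mi_le_trans sum.not_neutral_contains_not_neutral)

lemma eta_subst_nth_below:
  assumes "mi_le q s"
  shows "mfls_nth (eta_subst F) q = (\<Sum>p\<in>below s. mfls_nth F p * mfls_nth (E p) q)"
  unfolding eta_subst_nth
proof (rule sum.mono_neutral_left[OF finite_below])
  show "below q \<subseteq> below s" using assms by (auto simp: below_def intro: mi_le_trans)
  show "\<forall>p\<in>below s - below q. mfls_nth F p * mfls_nth (E p) q = 0"
  proof
    fix p assume p: "p \<in> below s - below q"
    then have "mfls_nth (E p) q = 0"
      using eta_pow_support(2)[of p q] by (auto simp: below_def)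
    then show "mfls_nth F p * mfls_nth (E p) q = 0" by simp
  qed
qed

text \<open>The infinite sum defining \<open>eta_subst F\<close> is multiplied by \<open>G\<close>
  term by term. \<open>G\<close> may have negative exponents, bounded by \<open>l\<close>, as does
  \<open>E q\<close> for general \<open>q\<close>.\<close>

lemma mult_eta_subst_nth:
  assumes l: "\<And>q. mfls_nth G q \<noteq> 0 \<Longrightarrow> mi_le l q"
  shows "mfls_nth (G * eta_subst F) q = (\<Sum>p\<in>below (q - l). mfls_nth F p * mfls_nth (G * E p) q)"
proof -
  let ?I = "{a. mi_le l a \<and> mi_le a q}"
  have "mfls_nth (G * eta_subst F) q = (\<Sum>a\<in>?I. mfls_nth G a * mfls_nth (eta_subst F) (q - a))"
    by (rule mfls_nth_mult_interval[OF l eta_subst_support, unfolded diff_zero])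
  also have "\<dots> = (\<Sum>a\<in>?I. \<Sum>p\<in>below (q - l). mfls_nth F p * (mfls_nth G a * mfls_nth (E p) (q - a)))"
  proof (rule sum.cong[OF refl])
    fix a assume "a \<in> ?I"
    then have "mi_le (q - a) (q - l)" by (simp add: mi_le_def lookup_minus)
    from eta_subst_nth_below[OF this, of F]
    show "mfls_nth G a * mfls_nth (eta_subst F) (q - a)
        = (\<Sum>p\<in>below (q - l). mfls_nth F p * (mfls_nth G a * mfls_nth (E p) (q - a)))"
      by (simp add: sum_distrib_left mult_ac)
  qed
  also have "\<dots> = (\<Sum>p\<in>below (q - l). mfls_nth F p * (\<Sum>a\<in>?I. mfls_nth G a * mfls_nth (E p) (q - a)))"
    by (subst sum.swap) (simp add: sum_distrib_left)
  also have "\<dots> = (\<Sum>p\<in>below (q - l). mfls_nth F p * mfls_nth (G * E p) q)"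
  proof (rule sum.cong[OF refl])
    fix p assume p: "p \<in> below (q - l)"
    have E: "mi_le 0 s" if "mfls_nth (E p) s \<noteq> 0" for s
      using p eta_pow_support(2)[OF _ that] by (auto simp: below_def intro: mi_le_trans)
    have "mfls_nth (G * E p) q = (\<Sum>a | mi_le l a \<and> mi_le a (q - 0). mfls_nth G a * mfls_nth (E p) (q - a))"
      by (rule mfls_nth_mult_interval[OF l E])
    then show "mfls_nth F p * (\<Sum>a\<in>?I. mfls_nth G a * mfls_nth (E p) (q - a)) = mfls_nth F p * mfls_nth (G * E p) q"
      by simp
  qed
  finally show ?thesis .
qed

text \<open>Termwise multiplication in each argument reduces the claim to
  \<open>E (p + s) = E p * E s\<close>. Collecting terms by \<open>t = p + s\<close> then gives the
  coefficients of \<open>F * G\<close>.\<close>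

lemma eta_subst_mult:
  assumes F: "F \<in> power_series_in V" and G: "G \<in> power_series_in V"
  shows "eta_subst (F * G) = eta_subst F * eta_subst G"
proof (rule mfls_eqI)
  fix q
  have "mfls_nth (eta_subst F * eta_subst G) q
      = (\<Sum>s\<in>below (q - 0). mfls_nth G s * mfls_nth (eta_subst F * E s) q)"
    by (rule mult_eta_subst_nth[OF eta_subst_support])
  also have "\<dots> = (\<Sum>s\<in>below q. mfls_nth G s * mfls_nth (E s * eta_subst F) q)"
    by (simp add: mult.commute)
  also have "\<dots> = (\<Sum>s\<in>below q. \<Sum>p\<in>below (q - s). mfls_nth F p * mfls_nth G s * mfls_nth (E (p + s)) q)"
  proof (rule sum.cong[OF refl])
    fix s assume s: "s \<in> below q"
    then have E: "mi_le s a" if "mfls_nth (E s) a \<noteq> 0" for a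
      using eta_pow_support(2)[OF _ that] by (simp add: below_def)
    have "mfls_nth (E s * eta_subst F) q = (\<Sum>p\<in>below (q - s). mfls_nth F p * mfls_nth (E s * E p) q)"
      by (rule mult_eta_subst_nth[OF E])
    then show "mfls_nth G s * mfls_nth (E s * eta_subst F) q
        = (\<Sum>p\<in>below (q - s). mfls_nth F p * mfls_nth G s * mfls_nth (E (p + s)) q)"
      by (simp add: eta_pow_add sum_distrib_left mult_ac)
  qed
  also have "\<dots> = (\<Sum>(s, p)\<in>(SIGMA s:below q. below (q - s)). mfls_nth F p * mfls_nth G s * mfls_nth (E (p + s)) q)"
    by (simp add: sum.Sigma finite_below)
  also have "\<dots> = (\<Sum>(t, p)\<in>(SIGMA t:below q. below t). mfls_nth F p * mfls_nth G (t - p) * mfls_nth (E t) q)"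
  proof (rule sum.reindex_bij_witness[of _ "\<lambda>(t, p). (t - p, p)" "\<lambda>(s, p). (p + s, p)"])
    fix x assume "x \<in> (SIGMA s:below q. below (q - s))"
    then obtain s p where x: "x = (s, p)" "s \<in> MI" "mi_le 0 s" "mi_le s q" "p \<in> MI" "mi_le 0 p" "mi_le p (q - s)"
      by (auto simp: below_def)
    then have "mi_le 0 (p + s)" "mi_le (p + s) q" "mi_le p (p + s)"
      by (auto simp: mi_le_def lookup_add lookup_minus le_diff_eq)
    with x show "(case x of (s, p) \<Rightarrow> (p + s, p)) \<in> (SIGMA t:below q. below t)"
      by (simp add: below_def MI_add)
  next
    fix x assume "x \<in> (SIGMA t:below q. below t)"
    then obtain t p where x: "x = (t, p)" "t \<in> MI" "mi_le 0 t" "mi_le t q" "p \<in> MI" "mi_le 0 p" "mi_le p t"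
      by (auto simp: below_def)
    have "mi_le (t - p) q"
      unfolding mi_le_def lookup_minus
    proof
      fix v show "lkp t v - lkp p v \<le> lkp q v"
        using mi_leD[OF x(4), of v] mi_leD[OF x(6), of v] by simp
    qed
    moreover have "mi_le 0 (t - p)" "mi_le p (q - (t - p))"
      using x by (auto simp: mi_le_def lookup_minus)
    ultimately show "(case x of (t, p) \<Rightarrow> (t - p, p)) \<in> (SIGMA s:below q. below (q - s))"
      using x by (simp add: below_def MI_diff)
  qed auto
  also have "\<dots> = (\<Sum>t\<in>below q. \<Sum>p\<in>below t. mfls_nth F p * mfls_nth G (t - p) * mfls_nth (E t) q)"
    by (simp add: sum.Sigma finite_below)
  also have "\<dots> = (\<Sum>t\<in>below q. mfls_nth (F * G) t * mfls_nth (E t) q)"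
  proof (rule sum.cong[OF refl])
    fix t
    have "mfls_nth (F * G) t = (\<Sum>p | mi_le 0 p \<and> mi_le p (t - 0). mfls_nth F p * mfls_nth G (t - p))"
      by (rule mfls_nth_mult_interval[OF power_series_inD(2)[OF F] power_series_inD(2)[OF G]])
    also have "\<dots> = (\<Sum>p | mi_le 0 p \<and> mi_le p t. mfls_nth F p * mfls_nth G (t - p))" by simp
    also have "\<dots> = (\<Sum>p\<in>below t. mfls_nth F p * mfls_nth G (t - p))"
    proof (rule sum.mono_neutral_right[OF finite_mi_interval])
      show "\<forall>p\<in>{p. mi_le 0 p \<and> mi_le p t} - below t. mfls_nth F p * mfls_nth G (t - p) = 0"
      proof
        fix p assume "p \<in> {p. mi_le 0 p \<and> mi_le p t} - below t"
        then have "mfls_nth F p = 0"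
          using power_series_inD(1)[OF F, of p] by (auto simp: below_def multi_indices_def)
        then show "mfls_nth F p * mfls_nth G (t - p) = 0" by simp
      qed
    qed (auto simp: below_def)
    finally show "(\<Sum>p\<in>below t. mfls_nth F p * mfls_nth G (t - p) * mfls_nth (E t) q)
        = mfls_nth (F * G) t * mfls_nth (E t) q"
      by (simp add: sum_distrib_right)
  qed
  finally show "mfls_nth (eta_subst (F * G)) q = mfls_nth (eta_subst F * eta_subst G) q"
    by (simp add: eta_subst_nth)
qed

lemma eta_subst_mono: 
  assumes "p \<in> MI" "mi_le 0 p"
  shows "eta_subst (mfls_mono p) = E p"
proof (rule mfls_eqI)
  fix q
  have "mfls_nth (eta_subst (mfls_mono p)) q = (\<Sum>s\<in>below q. if s = p then mfls_nth (E p) q else 0)"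
    unfolding eta_subst_nth by (intro sum.cong refl) (simp add: mfls_nth_mono)
  also have "\<dots> = mfls_nth (E p) q"
    using eta_pow_support(2)[OF assms(1), of q] assms finite_below[of q]
    by (cases "mi_le p q") (auto simp: below_def)
  finally show "mfls_nth (eta_subst (mfls_mono p)) q = mfls_nth (E p) q" .
qed

lemma eta_subst_1: "eta_subst 1 = 1"
  using eta_subst_mono[of 0] by (simp add: MI_0 mi_le_refl mfls_mono_0 eta_pow_0)

lemma eta_subst_0: "eta_subst 0 = 0"
  by (rule mfls_eqI) (simp add: eta_subst_nth)

lemma eta_subst_add: "eta_subst (F + G) = eta_subst F + eta_subst G"
  by (rule mfls_eqI) (simp add: eta_subst_nth distrib_right sum.distrib)

lemma eta_subst_X: "v \<in> V \<Longrightarrow> eta_subst (mfls_X v) = \<eta> v"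
proof -
  assume v: "v \<in> V"
  have "E (sgl v 1) = (\<Prod>w\<in>V. if w = v then \<eta> v else 1)"
    unfolding eta_pow_def by (intro prod.cong refl) (auto simp: lookup_single when_def)
  also have "\<dots> = \<eta> v" using v by (simp add: finite_vars)
  finally show ?thesis unfolding mfls_X_eq_mono
    using v by (subst eta_subst_mono) (auto simp: multi_indices_def mi_le_0_single)
qed

lemma eta_subst_inverse:
  assumes "F \<in> unit_series_in V"
  shows "eta_subst (inverse F) = inverse (eta_subst F)" "eta_subst F dvd 1"
proof -
  have 1: "eta_subst F * eta_subst (inverse F) = 1"
    using eta_subst_mult[of F "inverse F"] assms unit_series_in_inverse[OF assms]
    by (simp add: unit_series_in_power_series mfls_inverse_mult unit_series_in_unit eta_subst_1)
  then show "eta_subst (inverse F) = inverse (eta_subst F)" by (rule mfls_inverse_eqI [symmetric])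
  from 1 show "eta_subst F dvd 1" by (metis dvdI)
qed

lemma eta_subst_powi:
  assumes "F \<in> unit_series_in V"
  shows "eta_subst (F powi k) = eta_subst F powi k"
proof -
  have "F ^ n \<in> unit_series_in V \<and> eta_subst (F ^ n) = eta_subst F ^ n" if "F \<in> unit_series_in V" for F n
    using that by (induction n)
      (simp_all add: eta_subst_1 unit_series_in_1 eta_subst_mult unit_series_in_power_series unit_series_in_mult)
  then show ?thesis
    using assms by (simp add: power_int_def unit_series_in_inverse eta_subst_inverse)
qed

lemma eta_subst_prod:
  "(\<And>i. i \<in> I \<Longrightarrow> f i \<in> power_series_in V) \<Longrightarrow> eta_subst (prod f I) = (\<Prod>i\<in>I. eta_subst (f i))"
  by (induction I rule: infinite_finite_induct)
     (simp_all add: eta_subst_1 eta_subst_mult power_series_in_prod)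

lemma eta_subst_block_pow:
  assumes "\<And>j. j < k \<Longrightarrow> D j \<in> unit_series_in V" "\<And>j. j < k \<Longrightarrow> W j \<in> unit_series_in V"
    and "\<And>j. j < k \<Longrightarrow> eta_subst (D j) = D' j" "\<And>j. j < k \<Longrightarrow> eta_subst (W j) = W' j"
  shows "eta_subst (block_pow k D W a) = block_pow k D' W' a"
  unfolding block_pow_def
proof (subst eta_subst_prod)
  show "D j powi - a j * W j powi a j \<in> power_series_in V" if "j \<in> {..<k}" for j
    using that assms by (intro unit_series_in_power_series unit_series_in_mult unit_series_in_powi) auto
  show "(\<Prod>j<k. eta_subst (D j powi - a j * W j powi a j)) = (\<Prod>j<k. D' j powi - a j * W' j powi a j)"
    using assms by (intro prod.cong refl)
      (simp add: eta_subst_mult eta_subst_powi unit_series_in_power_series unit_series_in_powi)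
qed

lemma eta_subst_phi_pow: "eta_subst (phi_pow r rt mfls_X q) = phi_pow r rt \<eta> q"
proof -
  have "eta_subst (tri_series mfls_X VX VY j) = tri_series \<eta> VX VY j" if "j < r" for j
    using that by (simp add: tri_series_def eta_subst_add eta_subst_1 eta_subst_X)
  moreover have "eta_subst (tri_series mfls_X VXt VYt j) = tri_series \<eta> VXt VYt j" if "j < rt" for j
    using that by (simp add: tri_series_def eta_subst_add eta_subst_1 eta_subst_X)
  moreover have "eta_subst (bin_series r mfls_X VZ j) = bin_series r \<eta> VZ j"
    "eta_subst (bin_series rt mfls_X VZt j) = bin_series rt \<eta> VZt j" for j
    by (simp_all add: bin_series_def eta_subst_add eta_subst_0 eta_subst_1 eta_subst_X)
  ultimately show ?thesis
    unfolding phi_pow_def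
    by (subst eta_subst_mult)
       (simp_all add: eta_subst_block_pow[OF X.unit_tri_series(1) X.unit_bin_series(1)]
          eta_subst_block_pow[OF X.unit_tri_series(2) X.unit_bin_series(2)]
          unit_series_in_power_series unit_series_in_block_pow X.unit_tri_series X.unit_bin_series)
qed

section \<open>The two inverses\<close>

text \<open>This expands \<open>\<xi>\<^sup>q = \<eta>\<^sup>q \<phi>(\<eta>)\<^sup>-\<^sup>q\<close> in powers of \<open>\<eta>\<close>.\<close>

lemma sum_phi_pow_eta_pow:
  assumes "q \<in> MI"
  shows "(\<Sum>p\<in>below (s - q). mfls_nth (phi_pow r rt mfls_X (- q)) p * mfls_nth (E (q + p)) s)
    = (if s = q then 1 else 0)"
proof -
  \<comment> \<open>After substitution, phi(eta)^(-q) cancels the factor phi(eta)^q of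
    \<open>E q\<close> and leaves the bare monomial.\<close>
  have "E q * eta_subst (phi_pow r rt mfls_X (- q)) = mfls_mono q"
    using phi_pow_diff[of q q] assms by (simp add: eta_subst_phi_pow eta_pow_eq phi_pow_0 mult_ac)
  moreover have "mfls_nth (E q * eta_subst (phi_pow r rt mfls_X (- q))) s
      = (\<Sum>p\<in>below (s - q). mfls_nth (phi_pow r rt mfls_X (- q)) p * mfls_nth (E (q + p)) s)"
    unfolding eta_pow_add by (rule mult_eta_subst_nth) (rule eta_pow_support(2)[OF assms])
  ultimately show ?thesis by (simp add: mfls_nth_mono)
qed

text \<open>Row \<open>q\<close> of M carries the exponent \<open>-q\<close> of phi and column
  \<open>s\<close> of H the exponent \<open>s\<close>. Neither depends on the middle index
  \<open>q + p\<close>, so the matrix product is a convolution.\<close>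

lemma sum_phi_pow_calH:
  assumes q: "q \<in> MI" and s: "s \<in> MI" and le: "mi_le q s"
  shows "(\<Sum>p\<in>below (s - q). mfls_nth (phi_pow r rt mfls_X (- q)) p * calH r rt (q + p) s)
    = (if s = q then 1 else 0 :: 'a)"
proof -
  let ?F = "phi_pow r rt mfls_X (- q) :: (var, 'a) mfls" and ?G = "phi_pow r rt mfls_X s * jac r rt :: (var, 'a) mfls"
  have F: "?F \<in> power_series_in V" by (rule unit_series_in_power_series[OF X.unit_phi_pow])
  have G: "?G \<in> power_series_in V"
    by (intro power_series_in_mult power_series_in_jac unit_series_in_power_series X.unit_phi_pow)
  have "(\<Sum>p\<in>below (s - q). mfls_nth ?F p * calH r rt (q + p) s)
      = (\<Sum>p\<in>below (s - q). mfls_nth ?F p * mfls_nth ?G (s - q - p))"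
  proof (rule sum.cong[OF refl])
    fix p assume "p \<in> below (s - q)"
    then have "s - (q + p) \<in> MI" using q s by (simp add: below_def MI_add MI_diff)
    then show "mfls_nth ?F p * calH r rt (q + p) s = mfls_nth ?F p * mfls_nth ?G (s - q - p)"
      using calH_eq_nth[OF r rt, of s "q + p", where 'a = 'a] by (simp add: diff_diff_eq)
  qed
  also have "\<dots> = (\<Sum>p | mi_le 0 p \<and> mi_le p (s - q). mfls_nth ?F p * mfls_nth ?G (s - q - p))"
  proof (rule sum.mono_neutral_left[OF finite_mi_interval])
    show "\<forall>p\<in>{p. mi_le 0 p \<and> mi_le p (s - q)} - below (s - q). mfls_nth ?F p * mfls_nth ?G (s - q - p) = 0"
      using power_series_inD(1)[OF F] by (fastforce simp: below_def multi_indices_def)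
  qed (auto simp: below_def)
  also have "\<dots> = mfls_nth (?F * ?G) (s - q)"
    by (rule mfls_nth_mult_interval[OF power_series_inD(2)[OF F] power_series_inD(2)[OF G],
          unfolded diff_zero, symmetric])
  also have "?F * ?G = phi_pow r rt mfls_X (s - q) * jac r rt"
    by (simp add: X.phi_pow_diff[of s q] mult_ac)
  also have "mfls_nth \<dots> (s - q) = calH r rt 0 (s - q)"
    using calH_eq_nth[OF r rt, of "s - q" 0, where 'a = 'a] MI_diff[OF s q] by simp
  also have "\<dots> = (if s - q = 0 then 1 else 0)"
    using le by (intro calH_0 r rt MI_diff s q) (simp add: mi_le_def lookup_minus)
  finally show ?thesis by simp
qed

text \<open>
  Both sides solve the same system, which is unitriangular for the componentwise order, so that
  it can be solved downwards from \<open>s\<close>.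
\<close>

lemma eta_pow_nth_eq_calH:
  assumes "s \<in> MI" "q \<in> MI" "mi_le q s"
  shows "mfls_nth (E q) s = calH r rt q s"
  using assms(2,3)
proof (induction "mi_deg (s - q)" arbitrary: q rule: less_induct)
  case less
  let ?F = "phi_pow r rt mfls_X (- q) :: (var, 'a) mfls"
  have 0: "0 \<in> below (s - q)" "mfls_nth ?F 0 = 1"
    using less.prems X.unit_phi_pow[of "- q"]
    by (simp_all add: below_def MI_0 mi_le_refl mi_le_def lookup_minus unit_series_in_def)
  \<comment> \<open>The term \<open>p = 0\<close> is the diagonal one, with coefficient
    \<open>1\<close>; all others lie strictly closer to \<open>s\<close> and fall under the
    induction hypothesis.\<close>
  have split: "(\<Sum>p\<in>below (s - q). mfls_nth ?F p * x (q + p))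
      = x q + (\<Sum>p\<in>below (s - q) - {0}. mfls_nth ?F p * x (q + p))" for x
    using sum.remove[OF finite_below 0(1), of "\<lambda>p. mfls_nth ?F p * x (q + p)"] 0(2) by simp
  have "(\<Sum>p\<in>below (s - q) - {0}. mfls_nth ?F p * mfls_nth (E (q + p)) s)
      = (\<Sum>p\<in>below (s - q) - {0}. mfls_nth ?F p * calH r rt (q + p) s)"
  proof (rule sum.cong[OF refl])
    fix p assume "p \<in> below (s - q) - {0}"
    then have p: "p \<in> MI" "mi_le 0 p" "mi_le p (s - q)" "p \<noteq> 0" by (auto simp: below_def)
    have le: "mi_le 0 (s - (q + p))" "mi_le (q + p) s"
      using p(3) by (auto simp: mi_le_def lookup_minus lookup_add le_diff_eq algebra_simps)
    have "mi_deg (p + (s - (q + p))) = mi_deg p + mi_deg (s - (q + p))"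
      using p(2) le(1) by (rule mi_deg_add)
    moreover have "p + (s - (q + p)) = s - q" by (simp add: algebra_simps)
    ultimately have "mi_deg (s - (q + p)) < mi_deg (s - q)"
      using mi_deg_pos[OF p(2,4)] by simp
    then show "mfls_nth ?F p * mfls_nth (E (q + p)) s = mfls_nth ?F p * calH r rt (q + p) s"
      using less.hyps[of "q + p"] less.prems p le by (simp add: MI_add)
  qed
  moreover have "(\<Sum>p\<in>below (s - q). mfls_nth ?F p * mfls_nth (E (q + p)) s)
      = (\<Sum>p\<in>below (s - q). mfls_nth ?F p * calH r rt (q + p) s)"
    unfolding sum_phi_pow_eta_pow[OF less.prems(1)] sum_phi_pow_calH[OF less.prems(1) assms(1) less.prems(2)] ..
  ultimately show ?case
    unfolding split[of "\<lambda>q. mfls_nth (E q) s"] split[of "\<lambda>q. calH r rt q s"] by simp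
qed

end

theorem theorem4p1:
  fixes r rt :: nat
    and \<eta> :: "var \<Rightarrow> (var, 'a::field_char_0) mfls"
    and q' :: "var multi_index"
  assumes "r \<ge> 1" and "rt \<ge> 1"
    and "is_eta r rt \<eta>"
    and "q' \<in> multi_indices r rt"
  shows "\<forall>q. mfls_nth (\<Prod>v\<in>vars r rt. \<eta> v powi Poly_Mapping.lookup q' v) q =
    (if q \<in> multi_indices r rt \<and> mi_le q' q then calH r rt q' q else 0)"
proof
  fix q
  interpret eta_implicit r rt \<eta>
    using assms by unfold_locales (auto simp: is_eta_def)
  have "mfls_nth (E q') q = (if q \<in> MI \<and> mi_le q' q then calH r rt q' q else 0)"
    using eta_pow_nth_eq_calH[of q q'] eta_pow_support[of q' q] assms(4) by auto
  then show "mfls_nth (\<Prod>v\<in>vars r rt. \<eta> v powi Poly_Mapping.lookup q' v) q =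
    (if q \<in> multi_indices r rt \<and> mi_le q' q then calH r rt q' q else 0)"
    by (simp add: eta_pow_def)
qed

end
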